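(* Let $M$ be a closed connected Riemannian manifold with magnetic potential (smooth real $1$-form) $\boldsymbol{\alpha}$, let $n\in\mathbb{N}$, $n\ge1$, and let $F=(f_1,\dots,f_n):M\to\mathbb{C}^n$, where $f_1,\dots,f_n$ are $L^2$-orthonormal eigenfunctions of $\Delta^{\boldsymbol{\alpha}}$ for the eigenvalues $\lambda_1(\Delta^{\boldsymbol{\alpha}}),\dots,\lambda_n(\Delta^{\boldsymbol{\alpha}})$. Let $S\subseteq M$ and $\epsilon>0$, and let $\eta:M\to\mathbb{R}$ be the associated cut-off function $$\eta(x)=\begin{cases}0,&F(x)=0,\\ \max\{0,\,1-\tfrac1\epsilon d_F(x,S\cap M_F)\},&\text{otherwise.}\end{cases}$$ Then for almost every $x\in M$, $$\|(d+i\boldsymbol{\alpha})(\eta F)(x)\|^2\;\le\;2\Big(1+\frac4{\epsilon^2}\Big)\,\|(d+i\boldsymbol{\alpha})F(x)\|^2 .$$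
   Context: The magnetic Laplacian is $\Delta^{\boldsymbol{\alpha}}=D^*D$ with $D=d+i\boldsymbol{\alpha}$ mapping smooth complex functions to smooth complex $1$-forms and $D^*$ its formal $L^2$-adjoint; it has discrete spectrum $0\le\lambda_1(\Delta^{\boldsymbol{\alpha}})\le\lambda_2(\Delta^{\boldsymbol{\alpha}})\le\cdots\nearrow\infty$ (with multiplicity) and smooth eigenfunctions. $M_F=\{x\in M\mid F(x)\ne0\}$, and $d_F$ is the pseudometric on $M_F$ $$d_F(x,y)=\inf_{\gamma\in U(1)}\Big\|\frac{F(x)}{\|F(x)\|}-\gamma\frac{F(y)}{\|F(y)\|}\Big\|,$$ with $\|\cdot\|$ the standard Hermitian norm on $\mathbb{C}^n$ and $U(1)=\{z\in\mathbb{C}\mid|z|=1\}$; $d_F(x,A)=\inf_{y\in A}d_F(x,y)$ (equal to $+\infty$ if $A=\emptyset$, in which case $\eta\equiv0$). For $H=(h_1,\dots,h_n):M\to\mathbb{C}^n$, $\|(d+i\boldsymbol{\alpha})H(x)\|^2=\sum_{p=1}^n|(d+i\boldsymbol{\alpha})h_p(x)|^2$, with $|\cdot|$ the norm on complex cotangent vectors induced by the Riemannian metric. *)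

theory Defs
  imports "HOL-Analysis.Analysis" "HOL-Library.Function_Algebras"
begin

text \<open>
  Differential geometry is set up in the classical component style.  The manifold is a whole type
  \<open>'m\<close> (Hausdorff and second countable by its type classes), its smooth structure is given by an
  atlas with values in \<open>real^'d\<close> (so the dimension is \<open>CARD('d)\<close>), and tensor fields are families of
  component fields, one for each chart, that transform by the tensor law.
\<close>

section \<open>Smooth maps between Euclidean spaces\<close>

text \<open>Intended for open \<open>S\<close>.\<close>

primrec Ck_on :: "nat \<Rightarrow> 'a::real_normed_vector set \<Rightarrow> ('a \<Rightarrow> 'b::real_normed_vector) \<Rightarrow> bool" where
  "Ck_on 0 S f \<longleftrightarrow> continuous_on S f"
| "Ck_on (Suc k) S f \<longleftrightarrow>
     (\<forall>x\<in>S. f differentiable (at x)) \<and> (\<forall>v. Ck_on k S (\<lambda>x. frechet_derivative f (at x) v))"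

definition smooth_on :: "'a::real_normed_vector set \<Rightarrow> ('a \<Rightarrow> 'b::real_normed_vector) \<Rightarrow> bool" where
  "smooth_on S f \<longleftrightarrow> (\<forall>k. Ck_on k S f)"

section \<open>Smooth manifolds\<close>

type_synonym ('m, 'd) chart = "'m set \<times> ('m \<Rightarrow> real^'d)"

abbreviation chart_dom :: "('m, 'd) chart \<Rightarrow> 'm set" where
  "chart_dom c \<equiv> fst c"

abbreviation chart_map :: "('m, 'd) chart \<Rightarrow> 'm \<Rightarrow> real^'d" where
  "chart_map c \<equiv> snd c"

abbreviation chart_img :: "('m, 'd) chart \<Rightarrow> (real^'d) set" where
  "chart_img c \<equiv> chart_map c ` chart_dom c"

abbreviation chart_inv :: "('m, 'd) chart \<Rightarrow> real^'d \<Rightarrow> 'm" where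
  "chart_inv c \<equiv> inv_into (chart_dom c) (chart_map c)"

definition is_chart :: "('m::topological_space, 'd::finite) chart \<Rightarrow> bool" where
  "is_chart c \<longleftrightarrow> open (chart_dom c) \<and> open (chart_img c) \<and>
     homeomorphism (chart_dom c) (chart_img c) (chart_map c) (chart_inv c)"

definition smooth_atlas :: "('m::topological_space, 'd::finite) chart set \<Rightarrow> bool" where
  "smooth_atlas A \<longleftrightarrow>
     (\<forall>c\<in>A. is_chart c) \<and> (\<Union>c\<in>A. chart_dom c) = UNIV \<and>
     (\<forall>c\<in>A. \<forall>d\<in>A. smooth_on (chart_map c ` (chart_dom c \<inter> chart_dom d)) (chart_map d \<circ> chart_inv c))"

definition smooth_fun ::
    "('m, 'd::finite) chart set \<Rightarrow> ('m \<Rightarrow> 'b::real_normed_vector) \<Rightarrow> bool" where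
  "smooth_fun A u \<longleftrightarrow> (\<forall>c\<in>A. smooth_on (chart_img c) (u \<circ> chart_inv c))"

definition differentiable_at_point ::
    "('m, 'd::finite) chart set \<Rightarrow> ('m \<Rightarrow> 'b::real_normed_vector) \<Rightarrow> 'm \<Rightarrow> bool" where
  "differentiable_at_point A u x \<longleftrightarrow>
     (\<forall>c\<in>A. x \<in> chart_dom c \<longrightarrow> (u \<circ> chart_inv c) differentiable (at (chart_map c x)))"

section \<open>One-forms and Riemannian metrics\<close>

text \<open>
  If \<open>\<omega>\<close> is a one-form, then \<open>\<omega> c x $ j\<close> is its value at \<open>x\<close> on the \<open>j\<close>-th coordinate vector of the
  chart \<open>c\<close>.  Components are real for real forms and complex for complex forms.  Only the values
  at charts \<open>c \<in> A\<close> and points \<open>x \<in> chart_dom c\<close> are meaningful.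
\<close>

type_synonym ('m, 'd, 'b) form1 = "('m, 'd) chart \<Rightarrow> 'm \<Rightarrow> 'b^'d"

definition transition_jacobian ::
    "('m, 'd::finite) chart \<Rightarrow> ('m, 'd) chart \<Rightarrow> 'm \<Rightarrow> real^'d^'d" where
  "transition_jacobian c d x = jacobian (chart_map d \<circ> chart_inv c) (at (chart_map c x))"

definition smooth_form1 ::
    "('m, 'd::finite) chart set \<Rightarrow> ('m, 'd, 'b::real_normed_vector) form1 \<Rightarrow> bool" where
  "smooth_form1 A \<omega> \<longleftrightarrow>
     (\<forall>c\<in>A. smooth_on (chart_img c) (\<omega> c \<circ> chart_inv c)) \<and>
     (\<forall>c\<in>A. \<forall>d\<in>A. \<forall>x\<in>chart_dom c \<inter> chart_dom d.
        \<omega> c x = (\<chi> j. \<Sum>i\<in>UNIV. transition_jacobian c d x $ i $ j *\<^sub>R \<omega> d x $ i))"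

text \<open>\<open>g c x\<close> is the Gram matrix of the coordinate vectors of the chart \<open>c\<close> at \<open>x\<close>.\<close>

type_synonym ('m, 'd) metric = "('m, 'd) chart \<Rightarrow> 'm \<Rightarrow> real^'d^'d"

definition riemannian_metric ::
    "('m, 'd::finite) chart set \<Rightarrow> ('m, 'd) metric \<Rightarrow> bool" where
  "riemannian_metric A g \<longleftrightarrow>
     (\<forall>c\<in>A. smooth_on (chart_img c) (g c \<circ> chart_inv c)) \<and>
     (\<forall>c\<in>A. \<forall>x\<in>chart_dom c.
        transpose (g c x) = g c x \<and> (\<forall>v. v \<noteq> 0 \<longrightarrow> v \<bullet> (g c x *v v) > 0)) \<and>
     (\<forall>c\<in>A. \<forall>d\<in>A. \<forall>x\<in>chart_dom c \<inter> chart_dom d.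
        g c x = transpose (transition_jacobian c d x) ** g d x ** transition_jacobian c d x)"

text \<open>
  The pointwise Hermitian product of complex covectors, \<open>g\<^sup>i\<^sup>j \<xi>\<^sub>i \<zeta>\<^sub>j\<close> with the second argument
  conjugated, is evaluated in an arbitrary chart around the point; by the tensor law the
  choice is immaterial.
\<close>

definition chart_at :: "('m, 'd) chart set \<Rightarrow> 'm \<Rightarrow> ('m, 'd) chart" where
  "chart_at A x = (SOME c. c \<in> A \<and> x \<in> chart_dom c)"

definition covector_inner ::
    "('m, 'd::finite) chart set \<Rightarrow> ('m, 'd) metric \<Rightarrow> ('m, 'd, complex) form1 \<Rightarrow>
     ('m, 'd, complex) form1 \<Rightarrow> 'm \<Rightarrow> complex" where
  "covector_inner A g \<xi> \<zeta> x =
     (let c = chart_at A x in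
        \<Sum>i\<in>UNIV. \<Sum>j\<in>UNIV. of_real (matrix_inv (g c x) $ i $ j) * \<xi> c x $ i * cnj (\<zeta> c x $ j))"

definition covector_norm ::
    "('m, 'd::finite) chart set \<Rightarrow> ('m, 'd) metric \<Rightarrow> ('m, 'd, complex) form1 \<Rightarrow> 'm \<Rightarrow> real" where
  "covector_norm A g \<xi> x = sqrt (Re (covector_inner A g \<xi> \<xi> x))"

section \<open>Riemannian volume\<close>

text \<open>
  \<open>chart_volume g c B\<close> is the integral of \<open>sqrt (det g)\<close> over the coordinate image of \<open>B \<subseteq> chart_dom c\<close>.
  The volume measure adds up these contributions over a countable Borel partition of the manifold
  into pieces of chart domains; by the change of variables formula the choice of the partition
  is immaterial.
\<close>

definition chart_volume ::
    "('m, 'd::finite) metric \<Rightarrow> ('m, 'd) chart \<Rightarrow> 'm set \<Rightarrow> ennreal" where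
  "chart_volume g c B =
     (\<integral>\<^sup>+y. ennreal (sqrt (det (g c (chart_inv c y)))) * indicator (chart_map c ` B) y \<partial>lborel)"

definition chart_cover :: "('m, 'd) chart set \<Rightarrow> nat \<Rightarrow> ('m, 'd) chart" where
  "chart_cover A = (SOME cs. range cs \<subseteq> A \<and> (\<Union>i. chart_dom (cs i)) = UNIV)"

definition riemannian_volume ::
    "('m::topological_space, 'd::finite) chart set \<Rightarrow> ('m, 'd) metric \<Rightarrow> 'm measure" where
  "riemannian_volume A g = measure_of UNIV (sets borel)
     (\<lambda>B. \<Sum>i. chart_volume g (chart_cover A i)
                 (B \<inter> disjointed (\<lambda>j. chart_dom (chart_cover A j)) i))"

text \<open>
  The set function in \<open>riemannian_volume\<close> is countably additive, so \<open>measure_of\<close> does not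
  degenerate to the zero measure.
\<close>

lemma chart_cover_atlas:
  fixes A :: "('m::second_countable_topology, 'd::finite) chart set"
  assumes "smooth_atlas A"
  shows "chart_cover A i \<in> A" "(\<Union>i. chart_dom (chart_cover A i)) = UNIV"
proof -
  let ?P = "\<lambda>cs::nat \<Rightarrow> ('m, 'd) chart. range cs \<subseteq> A \<and> (\<Union>i. chart_dom (cs i)) = UNIV"
  have "\<And>U. U \<in> chart_dom ` A \<Longrightarrow> open U"
    using assms by (auto simp: smooth_atlas_def is_chart_def)
  then obtain D where D: "D \<subseteq> chart_dom ` A" "countable D" "\<Union>D = \<Union>(chart_dom ` A)"
    by (rule Lindelof)
  then obtain C where C: "C \<subseteq> A" "countable C" "D = chart_dom ` C"
    using countable_subset_image[of D chart_dom A] by blast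
  have "\<Union>(chart_dom ` C) = \<Union>(chart_dom ` A)"
    using D(3) C(3) by simp
  then have U: "\<Union>(chart_dom ` C) = UNIV"
    using assms by (simp add: smooth_atlas_def)
  then have "C \<noteq> {}" by auto
  then have R: "range (from_nat_into C) = C"
    using C(2) by (rule range_from_nat_into)
  have "(\<Union>i. chart_dom (from_nat_into C i)) = \<Union>(chart_dom ` range (from_nat_into C))"
    by (simp only: image_image)
  then have "?P (from_nat_into C)"
    using U C(1) unfolding R by simp
  then have "?P (chart_cover A)" unfolding chart_cover_def by (rule someI[where P = ?P])
  then show "chart_cover A i \<in> A" "(\<Union>i. chart_dom (chart_cover A i)) = UNIV" by auto
qed

lemma chart_image_borel:
  assumes "is_chart c" "B \<in> sets borel" "B \<subseteq> chart_dom c"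
  shows "chart_map c ` B \<in> sets borel"
proof -
  have h: "homeomorphism (chart_dom c) (chart_img c) (chart_map c) (chart_inv c)" "open (chart_img c)"
    using assms by (auto simp: is_chart_def)
  then have m: "chart_inv c \<in> measurable (restrict_space borel (chart_img c)) borel"
    by (intro borel_measurable_continuous_on_restrict) (auto simp: homeomorphism_def)
  have "chart_map c ` B = chart_inv c -` B \<inter> space (restrict_space borel (chart_img c))"
  proof (intro equalityI subsetI)
    fix y assume "y \<in> chart_map c ` B"
    then obtain x where "x \<in> B" "y = chart_map c x" by blast
    then show "y \<in> chart_inv c -` B \<inter> space (restrict_space borel (chart_img c))"
      using assms(3) homeomorphism_apply1[OF h(1), of x] by (auto simp: space_restrict_space)
  next
    fix y assume "y \<in> chart_inv c -` B \<inter> space (restrict_space borel (chart_img c))"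
    then have "chart_inv c y \<in> B" "y \<in> chart_img c" by (auto simp: space_restrict_space)
    then show "y \<in> chart_map c ` B"
      using homeomorphism_apply2[OF h(1), of y] by (metis imageI)
  qed
  with measurable_sets[OF m assms(2)] show ?thesis
    using h(2) by (simp add: sets_restrict_space_iff)
qed

lemma chart_density_measurable:
  assumes "smooth_atlas A" "riemannian_metric A g" "c \<in> A" "B \<in> sets borel" "B \<subseteq> chart_dom c"
  shows "(\<lambda>y. ennreal (sqrt (det (g c (chart_inv c y)))) * indicator (chart_map c ` B) y)
            \<in> borel_measurable lborel"
proof -
  have c: "is_chart c" and o: "open (chart_img c)"
    using assms(1,3) by (auto simp: smooth_atlas_def is_chart_def)
  have "Ck_on 0 (chart_img c) (g c \<circ> chart_inv c)"
    using assms(2,3) unfolding riemannian_metric_def smooth_on_def by blast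
  then have "continuous_on (chart_img c) (\<lambda>y. g c (chart_inv c y))" by (simp add: o_def)
  then have "continuous_on (chart_img c) (\<lambda>y. sqrt (det (g c (chart_inv c y))))"
    unfolding det_def by (intro continuous_intros)
  then have f: "(\<lambda>y. indicator (chart_img c) y *\<^sub>R sqrt (det (g c (chart_inv c y)))) \<in> borel_measurable borel"
    (is "?f \<in> _")
    using o by (intro borel_measurable_continuous_on_indicator) auto
  have "chart_map c ` B \<in> sets borel"
    using c assms(4,5) by (rule chart_image_borel)
  then have "(\<lambda>y. ennreal (?f y) * indicator (chart_map c ` B) y) \<in> borel_measurable lborel"
    using f by (intro borel_measurable_times_ennreal borel_measurable_indicator measurable_compose[OF _ measurable_ennreal]) simp_all
  also have "(\<lambda>y. ennreal (?f y) * indicator (chart_map c ` B) y) =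
      (\<lambda>y. ennreal (sqrt (det (g c (chart_inv c y)))) * indicator (chart_map c ` B) y)"
  proof
    fix y
    have "y \<in> chart_map c ` B \<Longrightarrow> y \<in> chart_img c" using assms(5) by blast
    then show "ennreal (?f y) * indicator (chart_map c ` B) y =
        ennreal (sqrt (det (g c (chart_inv c y)))) * indicator (chart_map c ` B) y"
      by (cases "y \<in> chart_map c ` B") simp_all
  qed
  finally show ?thesis .
qed

lemma inj_on_chart_map:
  assumes "is_chart c"
  shows "inj_on (chart_map c) (chart_dom c)"
proof (rule inj_onI)
  fix x y assume xy: "x \<in> chart_dom c" "y \<in> chart_dom c" "chart_map c x = chart_map c y"
  have h: "homeomorphism (chart_dom c) (chart_img c) (chart_map c) (chart_inv c)"
    using assms by (simp add: is_chart_def)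
  have "x = chart_inv c (chart_map c x)" by (rule homeomorphism_apply1[OF h xy(1), symmetric])
  also have "\<dots> = chart_inv c (chart_map c y)" by (simp only: xy(3))
  also have "\<dots> = y" by (rule homeomorphism_apply1[OF h xy(2)])
  finally show "x = y" .
qed

lemma emeasure_riemannian_volume:
  fixes A :: "('m::second_countable_topology, 'd::finite) chart set"
  assumes "smooth_atlas A" "riemannian_metric A g" "B \<in> sets borel"
  shows "emeasure (riemannian_volume A g) B =
    (\<Sum>i. chart_volume g (chart_cover A i) (B \<inter> disjointed (\<lambda>j. chart_dom (chart_cover A j)) i))"
proof -
  let ?c = "chart_cover A" and ?D = "disjointed (\<lambda>j. chart_dom (chart_cover A j))"
  let ?\<mu> = "\<lambda>B. \<Sum>i. chart_volume g (?c i) (B \<inter> ?D i)"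
  have cA: "?c i \<in> A" for i using chart_cover_atlas assms by blast
  have op: "open (chart_dom (?c i))" for i
    using cA assms by (auto simp: smooth_atlas_def is_chart_def)
  have D: "?D i \<in> sets borel" "?D i \<subseteq> chart_dom (?c i)" for i
  proof -
    have "chart_dom (?c j) \<in> sets borel" for j using op by simp
    then show "?D i \<in> sets borel" unfolding disjointed_def by (intro sets.Diff sets.finite_UN) auto
    show "?D i \<subseteq> chart_dom (?c i)" by (rule disjointed_subset)
  qed
  have "countably_additive (sets borel) ?\<mu>"
  proof (rule countably_additiveI)
    fix X :: "nat \<Rightarrow> 'm set"
    assume X: "range X \<subseteq> sets borel" "disjoint_family X"
    have "chart_volume g (?c i) (\<Union>(range X) \<inter> ?D i) = (\<Sum>k. chart_volume g (?c i) (X k \<inter> ?D i))" for i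
    proof -
      have inj: "inj_on (chart_map (?c i)) (chart_dom (?c i))"
        using cA[of i] assms(1) by (intro inj_on_chart_map) (simp add: smooth_atlas_def)
      have dis: "disjoint_family (\<lambda>k. chart_map (?c i) ` (X k \<inter> ?D i))"
        unfolding disjoint_family_on_def
      proof (intro ballI impI)
        fix m n :: nat assume "m \<noteq> n"
        then have "X m \<inter> X n = {}" using X by (auto simp: disjoint_family_on_def)
        then have "(X m \<inter> ?D i) \<inter> (X n \<inter> ?D i) = {}" by blast
        moreover have "X m \<inter> ?D i \<subseteq> chart_dom (?c i)" "X n \<inter> ?D i \<subseteq> chart_dom (?c i)"
          using D(2)[of i] by blast+
        ultimately show "chart_map (?c i) ` (X m \<inter> ?D i) \<inter> chart_map (?c i) ` (X n \<inter> ?D i) = {}"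
          using inj_on_image_Int[OF inj] by (metis image_empty)
      qed
      have "(indicator (chart_map (?c i) ` (\<Union>(range X) \<inter> ?D i)) y :: ennreal)
          = (\<Sum>k. indicator (chart_map (?c i) ` (X k \<inter> ?D i)) y)" for y
        unfolding suminf_indicator[OF dis] by (rule arg_cong[where f = "\<lambda>S. indicator S y"]) blast
      then have "chart_volume g (?c i) (\<Union>(range X) \<inter> ?D i) =
          (\<integral>\<^sup>+y. (\<Sum>k. ennreal (sqrt (det (g (?c i) (chart_inv (?c i) y))))
             * indicator (chart_map (?c i) ` (X k \<inter> ?D i)) y) \<partial>lborel)"
        unfolding chart_volume_def by (simp only: ennreal_suminf_cmult)
      also have "\<dots> = (\<Sum>k. chart_volume g (?c i) (X k \<inter> ?D i))"
        unfolding chart_volume_def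
      proof (rule nn_integral_suminf)
        fix k
        have "X k \<inter> ?D i \<in> sets borel" "X k \<inter> ?D i \<subseteq> chart_dom (?c i)" using X(1) D[of i] by auto
        then show "(\<lambda>y. ennreal (sqrt (det (g (?c i) (chart_inv (?c i) y))))
             * indicator (chart_map (?c i) ` (X k \<inter> ?D i)) y) \<in> borel_measurable lborel"
          by (rule chart_density_measurable[OF assms(1,2) cA])
      qed
      finally show ?thesis .
    qed
    then show "(\<Sum>k. ?\<mu> (X k)) = ?\<mu> (\<Union>(range X))"
      using nn_integral_suminf[of "\<lambda>i k. chart_volume g (?c i) (X k \<inter> ?D i)" "count_space UNIV"]
      by (simp only: nn_integral_count_space_nat) simp
  qed
  then show ?thesis
    using assms(3) sets.sigma_algebra_axioms[of "borel :: 'm measure"] unfolding riemannian_volume_def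
    by (subst emeasure_measure_of_sigma) (auto simp: positive_def chart_volume_def)
qed

definition L2_inner ::
    "('m::topological_space, 'd::finite) chart set \<Rightarrow> ('m, 'd) metric \<Rightarrow>
     ('m \<Rightarrow> complex) \<Rightarrow> ('m \<Rightarrow> complex) \<Rightarrow> complex" where
  "L2_inner A g u v = (LINT x|riemannian_volume A g. u x * cnj (v x))"

definition L2_inner_form1 ::
    "('m::topological_space, 'd::finite) chart set \<Rightarrow> ('m, 'd) metric \<Rightarrow>
     ('m, 'd, complex) form1 \<Rightarrow> ('m, 'd, complex) form1 \<Rightarrow> complex" where
  "L2_inner_form1 A g \<xi> \<zeta> = (LINT x|riemannian_volume A g. covector_inner A g \<xi> \<zeta> x)"

section \<open>Magnetic Laplacian\<close>

definition differential :: "('m \<Rightarrow> complex) \<Rightarrow> ('m, 'd::finite, complex) form1" where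
  "differential u c x =
     (\<chi> j. frechet_derivative (u \<circ> chart_inv c) (at (chart_map c x)) (axis j 1))"

definition magnetic_differential ::
    "('m, 'd::finite, real) form1 \<Rightarrow> ('m \<Rightarrow> complex) \<Rightarrow> ('m, 'd, complex) form1" where
  "magnetic_differential \<alpha> u c x =
     (\<chi> j. differential u c x $ j + \<i> * of_real (\<alpha> c x $ j) * u x)"

text \<open>The formal adjoint of \<open>magnetic_differential\<close>, from smooth one-forms to smooth functions.\<close>

definition magnetic_codifferential ::
    "('m::topological_space, 'd::finite) chart set \<Rightarrow> ('m, 'd) metric \<Rightarrow> ('m, 'd, real) form1 \<Rightarrow>
     ('m, 'd, complex) form1 \<Rightarrow> 'm \<Rightarrow> complex" where
  "magnetic_codifferential A g \<alpha> \<omega> =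
     (THE w. smooth_fun A w \<and>
        (\<forall>u. smooth_fun A u \<longrightarrow>
           L2_inner_form1 A g (magnetic_differential \<alpha> u) \<omega> = L2_inner A g u w))"

definition magnetic_laplacian ::
    "('m::topological_space, 'd::finite) chart set \<Rightarrow> ('m, 'd) metric \<Rightarrow> ('m, 'd, real) form1 \<Rightarrow>
     ('m \<Rightarrow> complex) \<Rightarrow> 'm \<Rightarrow> complex" where
  "magnetic_laplacian A g \<alpha> u = magnetic_codifferential A g \<alpha> (magnetic_differential \<alpha> u)"

definition magnetic_eigenspace ::
    "('m::topological_space, 'd::finite) chart set \<Rightarrow> ('m, 'd) metric \<Rightarrow> ('m, 'd, real) form1 \<Rightarrow>
     real \<Rightarrow> ('m \<Rightarrow> complex) set" where
  "magnetic_eigenspace A g \<alpha> t =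
     {u. smooth_fun A u \<and> magnetic_laplacian A g \<alpha> u = (\<lambda>x. of_real t * u x)}"

definition magnetic_eigenfunction ::
    "('m::topological_space, 'd::finite) chart set \<Rightarrow> ('m, 'd) metric \<Rightarrow> ('m, 'd, real) form1 \<Rightarrow>
     real \<Rightarrow> ('m \<Rightarrow> complex) \<Rightarrow> bool" where
  "magnetic_eigenfunction A g \<alpha> t u \<longleftrightarrow> u \<in> magnetic_eigenspace A g \<alpha> t \<and> u \<noteq> (\<lambda>x. 0)"

definition magnetic_multiplicity ::
    "('m::topological_space, 'd::finite) chart set \<Rightarrow> ('m, 'd) metric \<Rightarrow> ('m, 'd, real) form1 \<Rightarrow>
     real \<Rightarrow> nat" where
  "magnetic_multiplicity A g \<alpha> t =
     vector_space.dim (\<lambda>(a::complex) u x. a * u x) (magnetic_eigenspace A g \<alpha> t)"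

text \<open>
  \<open>magnetic_eigenvalue A g \<alpha> k\<close> is \<open>\<lambda>\<^sub>k\<close>, with \<open>k\<close> counted from \<open>1\<close>: the \<open>k\<close>-th term of the
  nondecreasing sequence that lists every eigenvalue as often as its multiplicity.
\<close>

definition magnetic_eigenvalue ::
    "('m::topological_space, 'd::finite) chart set \<Rightarrow> ('m, 'd) metric \<Rightarrow> ('m, 'd, real) form1 \<Rightarrow>
     nat \<Rightarrow> real" where
  "magnetic_eigenvalue A g \<alpha> k =
     (THE l :: nat \<Rightarrow> real. mono l \<and>
        (\<forall>t. finite {i. l i = t} \<and> card {i. l i = t} = magnetic_multiplicity A g \<alpha> t)) (k - 1)"

section \<open>Vector-valued maps and the cut-off function\<close>

text \<open>
  An element of \<open>\<complex>\<^sup>n\<close> is a function on \<open>{1..n}\<close>, encoded as \<open>nat \<Rightarrow> complex\<close> whose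
  values outside \<open>{1..n}\<close> are ignored; a map \<open>F\<close> into \<open>\<complex>\<^sup>n\<close> has the components \<open>\<lambda>x. F x p\<close>.
\<close>

definition cnorm :: "nat \<Rightarrow> (nat \<Rightarrow> complex) \<Rightarrow> real" where
  "cnorm n z = L2_set (\<lambda>p. cmod (z p)) {1..n}"

definition nonvanishing_set :: "nat \<Rightarrow> ('m \<Rightarrow> nat \<Rightarrow> complex) \<Rightarrow> 'm set" where
  "nonvanishing_set n F = {x. \<exists>p\<in>{1..n}. F x p \<noteq> 0}"

definition dist_map :: "nat \<Rightarrow> ('m \<Rightarrow> nat \<Rightarrow> complex) \<Rightarrow> 'm \<Rightarrow> 'm \<Rightarrow> real" where
  "dist_map n F x y =
     (INF \<gamma>\<in>{\<gamma>::complex. cmod \<gamma> = 1}.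
        cnorm n (\<lambda>p. F x p / of_real (cnorm n (F x)) - \<gamma> * (F y p / of_real (cnorm n (F y)))))"

definition dist_map_set :: "nat \<Rightarrow> ('m \<Rightarrow> nat \<Rightarrow> complex) \<Rightarrow> 'm \<Rightarrow> 'm set \<Rightarrow> ereal" where
  "dist_map_set n F x T = (INF y\<in>T. ereal (dist_map n F x y))"

definition cutoff ::
    "nat \<Rightarrow> ('m \<Rightarrow> nat \<Rightarrow> complex) \<Rightarrow> 'm set \<Rightarrow> real \<Rightarrow> 'm \<Rightarrow> real" where
  "cutoff n F S \<epsilon> x =
     (if x \<notin> nonvanishing_set n F then 0
      else real_of_ereal (max 0 (1 - ereal (1 / \<epsilon>) * dist_map_set n F x (S \<inter> nonvanishing_set n F))))"

definition magnetic_energy ::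
    "('m, 'd::finite) chart set \<Rightarrow> ('m, 'd) metric \<Rightarrow> ('m, 'd, real) form1 \<Rightarrow> nat \<Rightarrow>
     ('m \<Rightarrow> nat \<Rightarrow> complex) \<Rightarrow> 'm \<Rightarrow> real" where
  "magnetic_energy A g \<alpha> n H x =
     (\<Sum>p=1..n. (covector_norm A g (magnetic_differential \<alpha> (\<lambda>y. H y p)) x)\<^sup>2)"

end

theory Submission
  imports Defs
begin

text \<open>
  Rademacher's theorem is avoided.  A function on Euclidean space that is pointwise Lipschitz and
  touched, from below or from above, by a differentiable function at each point of a set is
  differentiable almost everywhere on this set, because the exceptional points are points of
  porosity of countably many sets, and these form a null set by Vitali's covering theorem.  At a point where
  \<open>F \<noteq> 0\<close> the cut-off \<open>\<eta>\<close> is touched by \<open>0\<close>, by \<open>1\<close>, or by \<open>1 - \<parallel>F / \<parallel>F\<parallel> - k\<parallel> / \<epsilon>\<close> for a nearest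
  point \<open>k\<close>; the norm \<open>\<parallel>F\<parallel>\<close> is touched by \<open>0\<close> at its zeros, so at almost every zero both \<open>\<parallel>F\<parallel>\<close> and
  \<open>\<eta> F\<close> have derivative zero.  Where \<open>\<eta>\<close> is differentiable and \<open>F \<noteq> 0\<close>, comparing \<open>F(x)\<close> with
  \<open>exp (\<i>t\<alpha>(v)) F(x + tv)\<close> gives \<open>\<bar>d\<eta>(v)\<bar> \<parallel>F\<parallel> \<le> (2/\<epsilon>) \<parallel>(d + \<i>\<alpha>)F(v)\<parallel>\<close>, and the estimate follows
  from the Leibniz rule and \<open>(a + b)\<^sup>2 \<le> 2a\<^sup>2 + 2b\<^sup>2\<close>.
\<close>

section \<open>Differentiability almost everywhere\<close>

text \<open>Vitali's theorem almost covers \<open>P\<close> by disjoint balls inside an open set of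
  measure barely above the outer measure \<open>m\<close> of \<open>P\<close>. Each ball contains a
  hole that misses \<open>P\<close> and fills a fixed fraction of the ball, so removing the holes
  leaves a cover of measure below \<open>m\<close>, unless \<open>m = 0\<close>. As \<open>P\<close>
  need not be measurable, \<open>m\<close> is an infimum over measurable covers.\<close>

lemma negligible_porous_bounded:
  fixes P :: "'a::euclidean_space set"
  assumes c: "0 < c" "c \<le> 1" and "bounded P"
    and hole: "\<And>x e. x \<in> P \<Longrightarrow> 0 < e \<Longrightarrow>
                  \<exists>y. x \<noteq> y \<and> dist x y < e \<and> ball y (c * dist x y) \<inter> P = {}"
  shows "negligible P"
proof -
  let ?\<mu> = "measure lebesgue"
  define covers where "covers = {T. P \<subseteq> T \<and> T \<in> lmeasurable}"
  define m where "m = Inf (?\<mu> ` covers)"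
  \<comment> \<open>The volume ratio of a hole of radius \<open>c * dist x y\<close> to its Vitali
    ball of radius \<open>2 * dist x y\<close>.\<close>
  define \<kappa> where "\<kappa> = (c / 2) ^ DIM('a)"
  have \<kappa>: "0 < \<kappa>" using c by (simp add: \<kappa>_def)
  have m_le: "m \<le> ?\<mu> T" if "T \<in> covers" for T
    unfolding m_def using that by (intro cInf_lower bdd_belowI[of _ 0]) auto
  obtain B where "P \<subseteq> ball 0 B"
    using bounded_subset_ballD[OF \<open>bounded P\<close>, of 0] by auto
  then have "ball 0 B \<in> covers"
    by (simp add: covers_def)
  then have ne: "covers \<noteq> {}" by blast
  have "0 \<le> m"
    unfolding m_def using ne by (intro cInf_greatest) auto
  have step: "\<kappa> * m \<le> 2 * e" if "e > 0" for e
  proof -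
    have "\<exists>T\<in>covers. ?\<mu> T < m + e"
      using cInf_lessD[of "?\<mu> ` covers" "m + e"] ne \<open>e > 0\<close> unfolding m_def by auto
    then obtain T where T: "P \<subseteq> T" "T \<in> lmeasurable" "?\<mu> T < m + e"
      by (auto simp: covers_def)
    obtain U where U: "open U" "T \<subseteq> U" "U - T \<in> lmeasurable" "emeasure lebesgue (U - T) < ennreal e"
      using sets_lebesgue_outer_open[of T e] T(2) \<open>e > 0\<close> by blast
    have Um: "U \<in> lmeasurable"
      using fmeasurable.Un[OF T(2) U(3)] U(2) by (simp add: Un_absorb1)
    have "?\<mu> U = ?\<mu> T + ?\<mu> (U - T)"
      using measure_Un3[OF T(2) U(3)] U(2) by (simp add: Un_absorb1)
    moreover have "?\<mu> (U - T) < e"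
      using U(3,4) \<open>e > 0\<close> by (simp add: emeasure_eq_measure2 ennreal_less_iff)
    ultimately have muU: "?\<mu> U < m + 2 * e"
      using T(3) by simp
    \<comment> \<open>The factor 2 makes the ball around \<open>x\<close> contain the whole hole
      around \<open>y\<close>, because \<open>c \<le> 1\<close>.\<close>
    define K where "K = {(x, y). x \<in> P \<and> x \<noteq> y \<and> ball y (c * dist x y) \<inter> P = {} \<and> ball x (2 * dist x y) \<subseteq> U}"
    define big where "big = (\<lambda>(x, y). ball x (2 * dist x y) :: 'a set)"
    define small where "small = (\<lambda>(x, y). ball y (c * dist x y) :: 'a set)"
    have "\<exists>i. i \<in> K \<and> x \<in> ball (fst i) (2 * dist (fst i) (snd i)) \<and> 2 * dist (fst i) (snd i) < d"
      if "x \<in> P" "0 < d" for x d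
    proof -
      have "x \<in> U" using that T(1) U(2) by blast
      then obtain d' where d': "d' > 0" "ball x d' \<subseteq> U"
        using U(1) open_contains_ball by blast
      obtain y where y: "x \<noteq> y" "dist x y < min d d' / 2" "ball y (c * dist x y) \<inter> P = {}"
        using hole[OF \<open>x \<in> P\<close>, of "min d d' / 2"] d' \<open>d > 0\<close> by auto
      moreover have "ball x (2 * dist x y) \<subseteq> ball x d'"
        using y(2) by (intro subset_ball) simp
      ultimately have "(x, y) \<in> K"
        using that(1) d'(2) unfolding K_def by blast
      then show ?thesis
        using y by (intro exI[of _ "(x, y)"]) simp
    qed
    then obtain C where C: "countable C" "C \<subseteq> K"
      "pairwise (\<lambda>i j. disjnt (ball (fst i) (2 * dist (fst i) (snd i))) (ball (fst j) (2 * dist (fst j) (snd j)))) C"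
      "negligible (P - (\<Union>i \<in> C. ball (fst i) (2 * dist (fst i) (snd i))))"
      by (rule Vitali_covering_theorem_balls[of P K fst "\<lambda>i. 2 * dist (fst i) (snd i)"])
    have big_eq: "big = (\<lambda>i. ball (fst i) (2 * dist (fst i) (snd i)))"
      unfolding big_def by auto
    have neg: "negligible (P - (\<Union>i\<in>C. big i))"
      using C(4) by (simp add: big_eq)
    have disj: "disjoint_family_on big C"
      using C(3) by (auto simp: disjoint_family_on_def pairwise_def disjnt_def big_eq)
    have sub: "small i \<subseteq> big i" for i
    proof
      fix z assume z: "z \<in> small i"
      obtain x y where i: "i = (x, y)" by force
      have "dist y z < c * dist x y" using z by (simp add: small_def i)
      also have "\<dots> \<le> dist x y" using c by (simp add: mult_left_le_one_le)
      finally show "z \<in> big i"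
        using dist_triangle[of x z y] by (simp add: big_def i)
    qed
    have disj': "disjoint_family_on small C"
      using disj sub unfolding disjoint_family_on_def by blast
    have sets: "small i \<in> sets lebesgue" "big i \<in> sets lebesgue" for i
      unfolding small_def big_def by (auto split: prod.split)
    have bigU: "(\<Union>i\<in>C. big i) \<subseteq> U"
      using C(2) by (fastforce simp: K_def big_def)
    have bigm: "(\<Union>i\<in>C. big i) \<in> lmeasurable"
      using sets C(1) bigU Um by (intro fmeasurableI2[OF Um bigU] sets.countable_UN') auto
    have smallm: "(\<Union>i\<in>C. small i) \<in> lmeasurable"
      using sets C(1) sub by (intro fmeasurableI2[OF bigm] sets.countable_UN') fastforce+
    have em: "emeasure lebesgue (small i) = ennreal \<kappa> * emeasure lebesgue (big i)" for i
    proof -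
      obtain x y where i: "i = (x, y)" by force
      have "emeasure lebesgue (small i) = ennreal (unit_ball_vol DIM('a) * (c * dist x y) ^ DIM('a))"
        using c by (simp add: small_def i emeasure_ball)
      also have "\<dots> = ennreal \<kappa> * ennreal (unit_ball_vol DIM('a) * (2 * dist x y) ^ DIM('a))"
        using \<kappa> by (subst ennreal_mult[symmetric])
          (auto simp: \<kappa>_def power_mult_distrib power_divide unit_ball_vol_nonneg field_simps)
      also have "\<dots> = ennreal \<kappa> * emeasure lebesgue (big i)"
        by (simp add: big_def i emeasure_ball)
      finally show ?thesis .
    qed
    have "emeasure lebesgue (\<Union>i\<in>C. small i) = ennreal \<kappa> * emeasure lebesgue (\<Union>i\<in>C. big i)"
      using sets C(1) disj disj' by (subst (1 2) emeasure_UN_countable) (auto simp: em nn_integral_cmult)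
    then have ms: "?\<mu> (\<Union>i\<in>C. small i) = \<kappa> * ?\<mu> (\<Union>i\<in>C. big i)"
      using \<kappa> by (simp add: measure_def enn2real_mult)
    \<comment> \<open>First cover: the Vitali balls together with the negligible rest of
      \<open>P\<close>. Hence the balls have measure at least \<open>m\<close>, and the holes at
      least \<open>\<kappa> * m\<close>.\<close>
    have "(\<Union>i\<in>C. big i) \<union> (P - (\<Union>i\<in>C. big i)) \<in> covers"
      using fmeasurable.Un[OF bigm negligible_imp_measurable[OF neg]]
      unfolding covers_def by blast
    from m_le[OF this] have mb: "m \<le> ?\<mu> (\<Union>i\<in>C. big i)"
      using neg bigm
      by (simp add: measure_Un_null_set fmeasurableD negligible_iff_null_sets del: Un_Diff_cancel)
    \<comment> \<open>Second cover: \<open>U\<close> without the holes. Comparing it with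
      \<open>m\<close> shows that the holes have measure at most \<open>?\<mu> U - m\<close>, which
      is less than \<open>2 * e\<close>.\<close>
    have "P \<inter> (\<Union>i\<in>C. small i) = {}"
      using C(2) by (fastforce simp: K_def small_def)
    then have "U - (\<Union>i\<in>C. small i) \<in> covers"
      using T(1) U(2) Um smallm unfolding covers_def by (auto intro: fmeasurable.Diff)
    from m_le[OF this] have "m \<le> ?\<mu> U - ?\<mu> (\<Union>i\<in>C. small i)"
      using Um smallm sub bigU by (subst (asm) measurable_measure_Diff) fastforce+
    then show ?thesis
      using muU mult_left_mono[OF mb less_imp_le[OF \<kappa>]] ms by linarith
  qed
  have "m \<le> 0"
  proof (rule ccontr)
    assume "\<not> m \<le> 0"
    then have "0 < \<kappa> * m" using \<kappa> by simp
    then show False using step[of "\<kappa> * m / 4"] by simp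
  qed
  show ?thesis
    unfolding negligible_outer_le
  proof (intro allI impI)
    fix e :: real assume "e > 0"
    then have "\<exists>T\<in>covers. ?\<mu> T < m + e"
      using cInf_lessD[of "?\<mu> ` covers" "m + e"] ne unfolding m_def by auto
    then obtain T where "T \<in> covers" "?\<mu> T < m + e" ..
    then show "\<exists>T. P \<subseteq> T \<and> T \<in> lmeasurable \<and> ?\<mu> T \<le> e"
      using \<open>m \<le> 0\<close> by (intro exI[of _ T]) (simp add: covers_def)
  qed
qed

text \<open>The exceptional points are those near which \<open>E\<close> has, at arbitrarily small
  scales, holes of size proportional to their distance. Sorting these points by a lower bound for
  the proportion and by their distance from the origin gives countably many bounded sets; a hole of
  \<open>E\<close> is also a hole of each of these subsets.\<close>

lemma negligible_porous:
  fixes E :: "'a::euclidean_space set"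
  shows "negligible {x\<in>E. \<not> (\<forall>c>0. \<exists>e>0. \<forall>y. dist x y < e \<longrightarrow> (\<exists>z\<in>E. dist y z \<le> c * dist x y))}"
    (is "negligible ?P")
proof -
  define Q where "Q k l = {x\<in>E. dist 0 x < real l \<and>
    (\<forall>e>0. \<exists>y. dist x y < e \<and> (\<forall>z\<in>E. inverse (real (Suc k)) * dist x y < dist y z))}" for k l
  have "negligible (Q k l)" for k l
  proof (rule negligible_porous_bounded)
    show "0 < inverse (real (Suc k))" "inverse (real (Suc k)) \<le> 1" by (simp_all add: field_simps)
    have "Q k l \<subseteq> ball 0 (real l)" by (auto simp: Q_def)
    then show "bounded (Q k l)" using bounded_ball bounded_subset by blast
    fix x e assume x: "x \<in> Q k l" and "0 < (e::real)"
    then obtain y where y: "dist x y < e" "\<forall>z\<in>E. inverse (real (Suc k)) * dist x y < dist y z"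
      by (auto simp: Q_def)
    moreover have "x \<in> E" using x by (simp add: Q_def)
    ultimately have "x \<noteq> y" by fastforce
    moreover have "ball y (inverse (real (Suc k)) * dist x y) \<inter> Q k l = {}"
      using y(2) by (force simp: Q_def)
    ultimately show "\<exists>y. x \<noteq> y \<and> dist x y < e \<and> ball y (inverse (real (Suc k)) * dist x y) \<inter> Q k l = {}"
      using y(1) by blast
  qed
  then have "negligible (\<Union>(range (\<lambda>(k, l). Q k l)))"
    by (intro negligible_countable_Union) auto
  moreover have "?P \<subseteq> \<Union>(range (\<lambda>(k, l). Q k l))"
  proof
    fix x assume x: "x \<in> ?P"
    then obtain c where c: "c > 0" "\<And>e. e > 0 \<Longrightarrow> \<exists>y. dist x y < e \<and> (\<forall>z\<in>E. c * dist x y < dist y z)"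
      by (auto simp: not_le)
    obtain k where k: "inverse (real (Suc k)) < c"
      using reals_Archimedean c(1) by blast
    obtain l where l: "dist 0 x < real l"
      using reals_Archimedean2 by blast
    have "x \<in> Q k l"
      unfolding Q_def
    proof (intro CollectI conjI allI impI)
      show "x \<in> E" "dist 0 x < real l" using x l by auto
      fix e :: real assume "e > 0"
      then obtain y where "dist x y < e" "\<forall>z\<in>E. c * dist x y < dist y z" using c by blast
      moreover have "inverse (real (Suc k)) * dist x y \<le> c * dist x y"
        using k by (intro mult_right_mono) auto
      ultimately show "\<exists>y. dist x y < e \<and> (\<forall>z\<in>E. inverse (real (Suc k)) * dist x y < dist y z)"
        using order.strict_trans1 by blast
    qed
    then show "x \<in> \<Union>(range (\<lambda>(k, l). Q k l))" by blast
  qed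
  ultimately show ?thesis using negligible_subset by blast
qed

text \<open>The touching function gives the lower half of differentiability at \<open>x\<close>. For
  the upper half, \<open>S\<close> is cut into countably many pieces with nearly constant slope and
  uniform constants. If \<open>x\<close> is not a point of porosity of its piece, every
  \<open>y\<close> near \<open>x\<close> has a point \<open>z\<close> of the piece much closer to
  \<open>y\<close> than \<open>x\<close> is. The lower bound for \<open>\<psi>\<close> based at
  \<open>z\<close>, evaluated at \<open>x\<close>, is an upper bound for \<open>\<psi> z\<close>,
  and the Lipschitz bound at \<open>z\<close> carries it over to \<open>y\<close>.\<close>

lemma negligible_not_differentiable_touched_below:
  fixes \<psi> :: "'a::euclidean_space \<Rightarrow> real"
  assumes lip: "\<And>x. x \<in> S \<Longrightarrow> \<exists>L. \<forall>\<^sub>F y in at x. \<bar>\<psi> y - \<psi> x\<bar> \<le> L * dist x y"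
    and touch: "\<And>x. x \<in> S \<Longrightarrow>
      \<exists>\<phi>. \<phi> differentiable (at x) \<and> \<phi> x = \<psi> x \<and> (\<forall>\<^sub>F y in at x. \<phi> y \<le> \<psi> y)"
  shows "negligible {x\<in>S. \<not> \<psi> differentiable (at x)}"
proof -
  obtain D :: "'a set" where D: "countable D" "\<And>X. open X \<Longrightarrow> X \<noteq> {} \<Longrightarrow> \<exists>d\<in>D. d \<in> X"
    using countable_dense_exists by metis
  \<comment> \<open>The slope \<open>p\<close> is only recorded up to \<open>1 / Suc k\<close> by a
    point \<open>\<xi>\<close> of a countable dense set, which keeps the family countable. The
    number \<open>m\<close> controls both the radius of validity and the Lipschitz constant.\<close>
  define E where "E = (\<lambda>(k::nat, \<xi>, m::nat). {x\<in>S. \<exists>p. dist p \<xi> < 1 / Suc k \<and>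
    (\<forall>y. dist x y < 1 / Suc m \<longrightarrow>
       p \<bullet> (y - x) - dist x y / Suc k \<le> \<psi> y - \<psi> x \<and> \<bar>\<psi> y - \<psi> x\<bar> \<le> Suc m * dist x y)})"
  define porous where "porous E = {x\<in>E. \<not> (\<forall>c>0. \<exists>e>0. \<forall>y. dist x y < e \<longrightarrow>
    (\<exists>z\<in>E. dist y z \<le> c * dist x y))}" for E :: "'a set"
  let ?N = "\<Union>i \<in> UNIV \<times> D \<times> UNIV. porous (E i)"
  have "negligible (porous F)" for F
    unfolding porous_def by (rule negligible_porous)
  then have N: "negligible ?N"
    using D(1) by (intro negligible_countable_Union) auto
  have "\<psi> differentiable (at x)" if x: "x \<in> S" "x \<notin> ?N" for x
  proof -
    obtain \<phi> \<phi>' where \<phi>: "(\<phi> has_derivative \<phi>') (at x)" "\<phi> x = \<psi> x" "\<forall>\<^sub>F y in at x. \<phi> y \<le> \<psi> y"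
      using touch[OF x(1)] by (auto simp: differentiable_def)
    \<comment> \<open>The gradient of the touching function, which turns out to be the gradient of
      \<open>\<psi>\<close> as well.\<close>
    define p where "p = adjoint \<phi>' 1"
    have p: "\<phi>' h = p \<bullet> h" for h
      using adjoint_works[OF has_derivative_linear[OF \<phi>(1)], of h 1]
      by (simp add: p_def inner_commute)
    obtain L where L: "\<forall>\<^sub>F y in at x. \<bar>\<psi> y - \<psi> x\<bar> \<le> L * dist x y"
      using lip[OF x(1)] by blast
    have "(\<psi> has_derivative (\<lambda>h. p \<bullet> h)) (at x)"
      unfolding has_derivative_at_alt
    proof (intro conjI allI impI)
      show "bounded_linear (\<lambda>h. p \<bullet> h)" by (rule bounded_linear_inner_right)
      fix e :: real assume "e > 0"
      obtain k where k: "inverse (real (Suc k)) < e / 8"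
        using reals_Archimedean[of "e / 8"] \<open>e > 0\<close> by auto
      define \<delta> where "\<delta> = 1 / real (Suc k)"
      have \<delta>: "0 < \<delta>" "\<delta> \<le> 1" "8 * \<delta> < e" using k by (simp_all add: \<delta>_def field_simps)
      obtain \<xi> where \<xi>: "\<xi> \<in> D" "dist p \<xi> < \<delta>"
        using D(2)[of "ball p \<delta>"] \<delta> by auto
      obtain d1 where d1: "0 < d1" "\<And>y. dist x y < d1 \<Longrightarrow> p \<bullet> (y - x) - \<delta> * dist x y \<le> \<psi> y - \<psi> x"
      proof -
        obtain d where d: "d > 0"
          "\<And>y. norm (y - x) < d \<Longrightarrow> norm (\<phi> y - \<phi> x - \<phi>' (y - x)) \<le> \<delta> * norm (y - x)"
          using \<phi>(1) \<delta>(1) unfolding has_derivative_at_alt by blast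
        obtain d' where d': "d' > 0" "\<And>y. y \<noteq> x \<Longrightarrow> dist y x < d' \<Longrightarrow> \<phi> y \<le> \<psi> y"
          using \<phi>(3) unfolding eventually_at by blast
        show ?thesis
        proof (rule that[of "min d d'"])
          show "0 < min d d'" using d d' by simp
          fix y assume y: "dist x y < min d d'"
          have "\<phi> y \<le> \<psi> y"
            using y d'(2)[of y] \<phi>(2) by (cases "y = x") (auto simp: dist_commute)
          moreover have "\<bar>\<phi> y - \<psi> x - p \<bullet> (y - x)\<bar> \<le> \<delta> * dist x y"
            using d(2)[of y] y by (simp add: dist_norm norm_minus_commute p \<phi>(2))
          ultimately show "p \<bullet> (y - x) - \<delta> * dist x y \<le> \<psi> y - \<psi> x"
            by linarith
        qed
      qed
      obtain d2 where d2: "0 < d2" "\<And>y. dist x y < d2 \<Longrightarrow> \<bar>\<psi> y - \<psi> x\<bar> \<le> L * dist x y"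
      proof -
        obtain d where d: "d > 0" "\<And>y. y \<noteq> x \<Longrightarrow> dist y x < d \<Longrightarrow> \<bar>\<psi> y - \<psi> x\<bar> \<le> L * dist x y"
          using L unfolding eventually_at by blast
        show ?thesis
        proof (rule that[OF d(1)])
          fix y assume "dist x y < d"
          then show "\<bar>\<psi> y - \<psi> x\<bar> \<le> L * dist x y"
            using d(2)[of y] by (cases "y = x") (auto simp: dist_commute)
        qed
      qed
      obtain m where "max L (max (1 / d1) (1 / d2)) < real m"
        using reals_Archimedean2 by blast
      then have mm: "max L (max (1 / d1) (1 / d2)) < real (Suc m)" by simp
      have m1: "1 / Suc m < d1" "1 / Suc m < d2" "L \<le> Suc m"
        using mm d1(1) d2(1) by (auto simp: field_simps)
      have xE: "x \<in> E (k, \<xi>, m)"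
        unfolding E_def
      proof (clarsimp, intro conjI exI allI impI)
        show "x \<in> S" by fact
        show "dist p \<xi> < 1 / (1 + real k)" using \<xi>(2) by (simp add: \<delta>_def)
        fix y assume "dist x y < 1 / (1 + real m)"
        then have y: "dist x y < 1 / Suc m" by simp
        show "p \<bullet> (y - x) - dist x y / (1 + real k) \<le> \<psi> y - \<psi> x"
          using d1(2)[of y] y m1(1) by (simp add: \<delta>_def)
        have "L * dist x y \<le> Suc m * dist x y"
          using m1(3) by (intro mult_right_mono) auto
        then show "\<bar>\<psi> y - \<psi> x\<bar> \<le> (1 + real m) * dist x y"
          using d2(2)[of y] y m1(2) by simp
      qed
      \<comment> \<open>Moving from \<open>y\<close> to \<open>z\<close> changes
        \<open>\<psi>\<close> by at most \<open>Suc m * dist y z\<close> and the linear part by at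
        most \<open>norm p * dist y z\<close>. With this \<open>c\<close> the two changes together
        are at most \<open>\<delta> * dist x y\<close>.\<close>
      define c where "c = \<delta> / (real (Suc m) + norm p)"
      have mp: "1 \<le> real (Suc m) + norm p" by simp
      have c: "0 < c" "c \<le> 1" "Suc m * c + norm p * c \<le> \<delta>"
      proof -
        show "0 < c" using \<delta> mp unfolding c_def by (intro divide_pos_pos) linarith+
        show "c \<le> 1" using \<delta> mp unfolding c_def by (subst divide_le_eq_1_pos) linarith+
        show "Suc m * c + norm p * c \<le> \<delta>"
          using mp \<delta>(1) unfolding c_def distrib_right[symmetric] by simp
      qed
      from xE x(2) \<xi>(1) have "x \<notin> porous (E (k, \<xi>, m))" by blast
      with xE c(1) obtain d3 where d3: "d3 > 0"
        "\<And>y. dist x y < d3 \<Longrightarrow> \<exists>z\<in>E (k, \<xi>, m). dist y z \<le> c * dist x y"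
        unfolding porous_def by blast
      show "\<exists>d>0. \<forall>y. norm (y - x) < d \<longrightarrow> norm (\<psi> y - \<psi> x - p \<bullet> (y - x)) \<le> e * norm (y - x)"
      \<comment> \<open>Since \<open>dist z x \<le> 2 * dist x y\<close>, half the radius of
        validity guarantees that the estimates based at \<open>z\<close> apply to
        \<open>x\<close>.\<close>
      proof (intro exI[of _ "min d3 (1 / (2 * Suc m))"] conjI allI impI)
        show "0 < min d3 (1 / (2 * Suc m))" using d3(1) by simp
        fix y assume "norm (y - x) < min d3 (1 / (2 * Suc m))"
        then have y: "dist x y < d3" "2 * dist x y < 1 / Suc m"
          by (simp_all add: dist_norm norm_minus_commute field_simps)
        have ym: "dist x y < 1 / Suc m" using y(2) zero_le_dist[of x y] by linarith
        obtain z where z: "z \<in> E (k, \<xi>, m)" "dist y z \<le> c * dist x y"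
          using d3(2)[OF y(1)] by blast
        have yz: "dist y z \<le> dist x y"
          using z(2) c mult_left_le_one_le[of "dist x y" c] by simp
        then have xz: "dist z x \<le> 2 * dist x y"
          using dist_triangle[of x z y] by (simp add: dist_commute)
        obtain q where q: "dist q \<xi> < \<delta>"
          and q': "\<And>w. dist z w < 1 / Suc m \<Longrightarrow>
             q \<bullet> (w - z) - \<delta> * dist z w \<le> \<psi> w - \<psi> z \<and> \<bar>\<psi> w - \<psi> z\<bar> \<le> Suc m * dist z w"
          using z(1) unfolding E_def by (auto simp: \<delta>_def)
        have "dist q p < 2 * \<delta>"
          using dist_triangle_less_add[of q \<xi> \<delta> p \<delta>] q \<xi>(2) by simp
        then have "\<bar>(q - p) \<bullet> (z - x)\<bar> \<le> 2 * \<delta> * (2 * dist x y)"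
          using Cauchy_Schwarz_ineq2[of "q - p" "z - x"] xz \<delta>
            mult_mono[of "norm (q - p)" "2 * \<delta>" "norm (z - x)" "2 * dist x y"]
          by (simp add: dist_norm)
        moreover have "\<bar>p \<bullet> (z - y)\<bar> \<le> norm p * (c * dist x y)"
          using Cauchy_Schwarz_ineq2[of p "z - y"] z(2)
            mult_left_mono[of "norm (z - y)" "c * dist x y" "norm p"]
          by (simp add: dist_norm norm_minus_commute)
        \<comment> \<open>The central step: touching from below at \<open>z\<close>, tested at
          \<open>x\<close>, bounds \<open>\<psi> z\<close> from above.\<close>
        moreover have "q \<bullet> (x - z) - \<delta> * dist z x \<le> \<psi> x - \<psi> z"
          using q'[of x] xz y(2) by simp
        moreover have "\<delta> * dist z x \<le> \<delta> * (2 * dist x y)"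
          using xz \<delta> by (intro mult_left_mono) auto
        moreover have "\<bar>\<psi> y - \<psi> z\<bar> \<le> Suc m * (c * dist x y)"
        proof -
          have "dist z y < 1 / Suc m" using yz ym by (simp add: dist_commute)
          then have "\<bar>\<psi> y - \<psi> z\<bar> \<le> Suc m * dist z y" using q'[of y] by blast
          also have "\<dots> \<le> Suc m * (c * dist x y)"
            using z(2) by (intro mult_left_mono) (auto simp: dist_commute)
          finally show ?thesis .
        qed
        moreover have "Suc m * (c * dist x y) + norm p * (c * dist x y) \<le> \<delta> * dist x y"
          using mult_right_mono[OF c(3) zero_le_dist[of x y]] by (simp add: algebra_simps)
        moreover have "(q - p) \<bullet> (z - x) = - (q \<bullet> (x - z)) - p \<bullet> (y - x) - p \<bullet> (z - y)"
          by (simp add: algebra_simps)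
        \<comment> \<open>The errors are \<open>4 * \<delta>\<close> from the slope difference
          \<open>q - p\<close>, \<open>2 * \<delta>\<close> from the estimate at \<open>z\<close>
          and \<open>\<delta>\<close> from replacing \<open>y\<close> by \<open>z\<close>, each
          times \<open>dist x y\<close>.\<close>
        ultimately have "\<psi> y - \<psi> x - p \<bullet> (y - x) \<le> 8 * \<delta> * dist x y"
          by linarith
        moreover have "- (\<delta> * dist x y) \<le> \<psi> y - \<psi> x - p \<bullet> (y - x)"
          using d1(2)[of y] ym m1(1) by linarith
        moreover have "8 * \<delta> * dist x y \<le> e * dist x y" "\<delta> * dist x y \<le> e * dist x y"
          using \<delta> by (intro mult_right_mono; simp)+
        ultimately show "norm (\<psi> y - \<psi> x - p \<bullet> (y - x)) \<le> e * norm (y - x)"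
          by (simp add: dist_norm norm_minus_commute abs_le_iff)
      qed
    qed
    then show ?thesis by (auto simp: differentiable_def)
  qed
  then have "{x\<in>S. \<not> \<psi> differentiable (at x)} \<subseteq> ?N" by blast
  with N show ?thesis by (rule negligible_subset)
qed

text \<open>Touching from above is touching from below for \<open>- \<psi>\<close>, so the set
  splits into two parts that are treated separately.\<close>

corollary negligible_not_differentiable_touched:
  fixes \<psi> :: "'a::euclidean_space \<Rightarrow> real"
  assumes lip: "\<And>x. x \<in> S \<Longrightarrow> \<exists>L. \<forall>\<^sub>F y in at x. \<bar>\<psi> y - \<psi> x\<bar> \<le> L * dist x y"
    and touch: "\<And>x. x \<in> S \<Longrightarrow>
      \<exists>\<phi>. \<phi> differentiable (at x) \<and> \<phi> x = \<psi> x \<and>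
        ((\<forall>\<^sub>F y in at x. \<phi> y \<le> \<psi> y) \<or> (\<forall>\<^sub>F y in at x. \<psi> y \<le> \<phi> y))"
  shows "negligible {x\<in>S. \<not> \<psi> differentiable (at x)}"
proof -
  define S1 where "S1 = {x\<in>S. \<exists>\<phi>. \<phi> differentiable (at x) \<and> \<phi> x = \<psi> x \<and> (\<forall>\<^sub>F y in at x. \<phi> y \<le> \<psi> y)}"
  define S2 where "S2 = {x\<in>S. \<exists>\<phi>. \<phi> differentiable (at x) \<and> \<phi> x = \<psi> x \<and> (\<forall>\<^sub>F y in at x. \<psi> y \<le> \<phi> y)}"
  have "negligible {x\<in>S1. \<not> \<psi> differentiable (at x)}"
    by (rule negligible_not_differentiable_touched_below) (auto simp: S1_def lip)
  moreover have "negligible {x\<in>S2. \<not> (\<lambda>x. - \<psi> x) differentiable (at x)}"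
  proof (rule negligible_not_differentiable_touched_below)
    fix x assume x: "x \<in> S2"
    show "\<exists>L. \<forall>\<^sub>F y in at x. \<bar>- \<psi> y - - \<psi> x\<bar> \<le> L * dist x y"
      using lip[of x] x by (simp add: S2_def abs_minus_commute)
    obtain \<phi> where "\<phi> differentiable (at x)" "\<phi> x = \<psi> x" "\<forall>\<^sub>F y in at x. \<psi> y \<le> \<phi> y"
      using x by (auto simp: S2_def)
    then show "\<exists>\<phi>. \<phi> differentiable at x \<and> \<phi> x = - \<psi> x \<and> (\<forall>\<^sub>F y in at x. \<phi> y \<le> - \<psi> y)"
      by (intro exI[of _ "\<lambda>y. - \<phi> y"]) simp
  qed
  moreover have "{x\<in>S. \<not> \<psi> differentiable (at x)} \<subseteq>
      {x\<in>S1. \<not> \<psi> differentiable (at x)} \<union> {x\<in>S2. \<not> (\<lambda>x. - \<psi> x) differentiable (at x)}"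
  proof
    fix x assume x: "x \<in> {x\<in>S. \<not> \<psi> differentiable (at x)}"
    then have "x \<in> S1 \<or> x \<in> S2" using touch[of x] unfolding S1_def S2_def by blast
    moreover have "\<not> (\<lambda>x. - \<psi> x) differentiable (at x)"
      using x differentiable_minus[of "\<lambda>x. - \<psi> x"] by auto
    ultimately show "x \<in> {x\<in>S1. \<not> \<psi> differentiable (at x)} \<union> {x\<in>S2. \<not> (\<lambda>x. - \<psi> x) differentiable (at x)}"
      using x by blast
  qed
  ultimately show ?thesis by (meson negligible_Un negligible_subset)
qed

section \<open>The cut-off function\<close>

lemma cnorm_nonneg [simp]: "0 \<le> cnorm n z"
  by (simp add: cnorm_def)

lemma cnorm_power2: "(cnorm n z)\<^sup>2 = (\<Sum>p=1..n. (cmod (z p))\<^sup>2)"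
  by (simp add: cnorm_def L2_set_def sum_nonneg)

lemma cnorm_triangle: "cnorm n (\<lambda>p. a p + b p) \<le> cnorm n a + cnorm n b"
proof -
  have "cnorm n (\<lambda>p. a p + b p) \<le> L2_set (\<lambda>p. cmod (a p) + cmod (b p)) {1..n}"
    unfolding cnorm_def by (intro L2_set_mono norm_triangle_ineq) auto
  also have "\<dots> \<le> cnorm n a + cnorm n b"
    unfolding cnorm_def by (rule L2_set_triangle_ineq)
  finally show ?thesis .
qed

lemma cnorm_diff_triangle:
  "cnorm n (\<lambda>p. a p - c p) \<le> cnorm n (\<lambda>p. a p - b p) + cnorm n (\<lambda>p. b p - c p)"
  using cnorm_triangle[of n "\<lambda>p. a p - b p" "\<lambda>p. b p - c p"] by simp

lemma cnorm_mult: "cnorm n (\<lambda>p. c * z p) = cmod c * cnorm n z"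
  by (simp add: cnorm_def norm_mult L2_set_right_distrib)

lemma cnorm_minus_commute: "cnorm n (\<lambda>p. a p - b p) = cnorm n (\<lambda>p. b p - a p)"
  by (simp add: cnorm_def norm_minus_commute)

lemma cnorm_reverse_triangle: "\<bar>cnorm n a - cnorm n b\<bar> \<le> cnorm n (\<lambda>p. a p - b p)"
  using cnorm_triangle[of n "\<lambda>p. a p - b p" b] cnorm_triangle[of n "\<lambda>p. b p - a p" a]
    cnorm_minus_commute[of n a b] by simp

lemma cnorm_eq_0_iff: "cnorm n z = 0 \<longleftrightarrow> (\<forall>p\<in>{1..n}. z p = 0)"
  by (simp add: cnorm_def L2_set_eq_0_iff)

lemma cmod_le_cnorm: "p \<in> {1..n} \<Longrightarrow> cmod (z p) \<le> cnorm n z"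
  unfolding cnorm_def by (intro member_le_L2_set) auto

lemma nonvanishing_set_iff: "x \<in> nonvanishing_set n F \<longleftrightarrow> cnorm n (F x) > 0"
  using cnorm_eq_0_iff[of n "F x"] cnorm_nonneg[of n "F x"]
  by (auto simp: nonvanishing_set_def less_le)

definition cunit :: "nat \<Rightarrow> (nat \<Rightarrow> complex) \<Rightarrow> nat \<Rightarrow> complex" where
  "cunit n z p = z p / of_real (cnorm n z)"

lemma cnorm_cunit: "cnorm n z > 0 \<Longrightarrow> cnorm n (cunit n z) = 1"
  using cnorm_mult[of n "1 / of_real (cnorm n z)" z] by (simp add: cunit_def[abs_def] norm_divide)

lemma cunit_mult: "cmod \<gamma> = 1 \<Longrightarrow> cunit n (\<lambda>p. \<gamma> * z p) p = \<gamma> * cunit n z p"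
  by (simp add: cunit_def cnorm_mult)

text \<open>Passing through \<open>b / cnorm n a\<close> costs the norm of \<open>a - b\<close> over
  the norm of \<open>a\<close> twice: once for changing the vector, once for changing the
  normalising factor. The resulting constant 2 is the source of the 4 in the final estimate.\<close>

lemma cnorm_cunit_diff_le:
  assumes "cnorm n a > 0" "cnorm n b > 0"
  shows "cnorm n (\<lambda>p. cunit n a p - cunit n b p) \<le> 2 * cnorm n (\<lambda>p. a p - b p) / cnorm n a"
proof -
  let ?A = "cnorm n a" and ?B = "cnorm n b" and ?D = "cnorm n (\<lambda>p. a p - b p)"
  have 1: "cnorm n (\<lambda>p. cunit n a p - b p / of_real ?A) = ?D / ?A"
    using cnorm_mult[of n "1 / of_real ?A" "\<lambda>p. a p - b p"] assms
    by (simp add: cunit_def norm_divide diff_divide_distrib)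
  have "cnorm n (\<lambda>p. b p / of_real ?A - cunit n b p) = cnorm n (\<lambda>p. of_real (1 / ?A - 1 / ?B) * b p)"
    by (simp add: cunit_def algebra_simps)
  also have "\<dots> = \<bar>1 / ?A - 1 / ?B\<bar> * ?B"
    by (simp only: cnorm_mult norm_of_real)
  also have "1 / ?A - 1 / ?B = (?B - ?A) / (?A * ?B)"
    using assms by (simp add: field_simps)
  also have "\<bar>\<dots>\<bar> * ?B = \<bar>?A - ?B\<bar> / ?A"
    using assms by (simp add: abs_divide abs_mult abs_minus_commute)
  also have "\<dots> \<le> ?D / ?A"
    using cnorm_reverse_triangle assms by (intro divide_right_mono) auto
  finally show ?thesis
    using cnorm_diff_triangle[of n "cunit n a" "cunit n b" "\<lambda>p. b p / of_real ?A"] 1 by simp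
qed

section \<open>The cut-off as a function of the distance to a phase-invariant set\<close>

definition unitary_orbit :: "nat \<Rightarrow> ('m \<Rightarrow> nat \<Rightarrow> complex) \<Rightarrow> 'm set \<Rightarrow> (nat \<Rightarrow> complex) set" where
  "unitary_orbit n F T = {\<lambda>p. \<gamma> * cunit n (F y) p | \<gamma> y. cmod \<gamma> = 1 \<and> y \<in> T}"

lemma unitary_orbit_nonempty:
  assumes "T \<noteq> {}"
  shows "unitary_orbit n F T \<noteq> {}"
proof -
  obtain y where "y \<in> T" using assms by blast
  then have "(\<lambda>p. 1 * cunit n (F y) p) \<in> unitary_orbit n F T"
    unfolding unitary_orbit_def using norm_one by blast
  then show ?thesis by blast
qed

text \<open>The infima over the phase and over the points of \<open>S\<close> merge into one infimum
  over a set of unit vectors. The pseudometric is thereby replaced by an ordinary distance to a set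
  in complex n-space.\<close>

lemma cutoff_eq_orbit_distance:
  assumes x: "x \<in> nonvanishing_set n F" and T: "S \<inter> nonvanishing_set n F \<noteq> {}"
  shows "cutoff n F S \<epsilon> x =
    max 0 (1 - (INF k\<in>unitary_orbit n F (S \<inter> nonvanishing_set n F). cnorm n (\<lambda>p. cunit n (F x) p - k p)) / \<epsilon>)"
proof -
  let ?T = "S \<inter> nonvanishing_set n F" and ?U = "{\<gamma>::complex. cmod \<gamma> = 1}"
  let ?K = "unitary_orbit n F ?T" and ?d = "\<lambda>k. cnorm n (\<lambda>p. cunit n (F x) p - k p)"
  have bdd: "bdd_below (?d ` X)" for X by (rule bdd_belowI[of _ 0]) auto
  have dm: "dist_map n F x y = (INF \<gamma>\<in>?U. ?d (\<lambda>p. \<gamma> * cunit n (F y) p))" for y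
    by (simp add: dist_map_def cunit_def)
  have bdd': "bdd_below ((\<lambda>\<gamma>. ?d (\<lambda>p. \<gamma> * cunit n (F y) p)) ` ?U)" for y
    by (rule bdd_belowI[of _ 0]) auto
  have "1 \<in> ?U" by simp
  then have ne: "?U \<noteq> {}" by blast
  have dm0: "0 \<le> dist_map n F x y" for y
    unfolding dm by (rule cINF_greatest[OF ne]) simp
  then have bdd'': "bdd_below (dist_map n F x ` X)" for X by (intro bdd_belowI[of _ 0]) auto
  have "(INF y\<in>?T. dist_map n F x y) = (INF k\<in>?K. ?d k)"
  proof (rule antisym)
    show "(INF y\<in>?T. dist_map n F x y) \<le> (INF k\<in>?K. ?d k)"
    proof (rule cINF_greatest)
      show "?K \<noteq> {}" using T by (rule unitary_orbit_nonempty)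
      fix k assume "k \<in> ?K"
      then obtain \<gamma> y where k: "k = (\<lambda>p. \<gamma> * cunit n (F y) p)" "cmod \<gamma> = 1" "y \<in> ?T"
        by (auto simp: unitary_orbit_def)
      have "(INF y\<in>?T. dist_map n F x y) \<le> dist_map n F x y"
        by (rule cINF_lower[OF bdd'' k(3)])
      also have "\<dots> \<le> ?d k"
        unfolding dm k(1) using k(2) by (intro cINF_lower[OF bdd']) simp
      finally show "(INF y\<in>?T. dist_map n F x y) \<le> ?d k" .
    qed
    show "(INF k\<in>?K. ?d k) \<le> (INF y\<in>?T. dist_map n F x y)"
    proof (rule cINF_greatest[OF T])
      fix y assume y: "y \<in> ?T"
      show "(INF k\<in>?K. ?d k) \<le> dist_map n F x y"
        unfolding dm
      proof (rule cINF_greatest[OF ne])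
        fix \<gamma> :: complex assume "\<gamma> \<in> ?U"
        then have "(\<lambda>p. \<gamma> * cunit n (F y) p) \<in> ?K"
          using y unfolding unitary_orbit_def by blast
        then show "(INF k\<in>?K. ?d k) \<le> ?d (\<lambda>p. \<gamma> * cunit n (F y) p)"
          by (rule cINF_lower[OF bdd])
      qed
    qed
  qed
  \<comment> \<open>As the set is nonempty and the distances are bounded below, the extended real
    infimum is the real one.\<close>
  moreover have "dist_map_set n F x ?T = ereal (INF y\<in>?T. dist_map n F x y)"
    unfolding dist_map_set_def using ereal_Inf'[OF bdd''[of ?T]] T by (simp add: image_image)
  moreover have "real_of_ereal (max 0 (1 - ereal (1 / \<epsilon>) * ereal r)) = max 0 (1 - r / \<epsilon>)" for r
    by (simp add: one_ereal_def zero_ereal_def max_def)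
  ultimately show ?thesis
    using x by (simp add: cutoff_def del: times_ereal.simps)
qed

text \<open>The infimum over the empty set is plus infinity, which turns the argument of
  \<open>max 0\<close> into minus infinity.\<close>

lemma cutoff_eq_0:
  assumes "S \<inter> nonvanishing_set n F = {}" "\<epsilon> > 0"
  shows "cutoff n F S \<epsilon> x = 0"
  using assms by (simp add: cutoff_def dist_map_set_def top_ereal_def max_def one_ereal_def zero_ereal_def)

lemma cutoff_bounds:
  assumes "\<epsilon> > 0"
  shows "0 \<le> cutoff n F S \<epsilon> x" "cutoff n F S \<epsilon> x \<le> 1"
proof -
  have "0 \<le> cutoff n F S \<epsilon> x \<and> cutoff n F S \<epsilon> x \<le> 1"
  proof (cases "x \<in> nonvanishing_set n F \<and> S \<inter> nonvanishing_set n F \<noteq> {}")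
    case True
    let ?K = "unitary_orbit n F (S \<inter> nonvanishing_set n F)"
    have "?K \<noteq> {}" using True by (intro unitary_orbit_nonempty) simp
    then have "0 \<le> (INF k\<in>?K. cnorm n (\<lambda>p. cunit n (F x) p - k p))"
      by (intro cINF_greatest) auto
    then show ?thesis
      using True assms by (simp add: cutoff_eq_orbit_distance)
  next
    case False
    have "cutoff n F S \<epsilon> x = 0"
    proof (cases "x \<in> nonvanishing_set n F")
      case True
      with False show ?thesis by (intro cutoff_eq_0[OF _ assms]) simp
    qed (simp add: cutoff_def)
    then show ?thesis by simp
  qed
  then show "0 \<le> cutoff n F S \<epsilon> x" "cutoff n F S \<epsilon> x \<le> 1" by auto
qed

text \<open>The orbit is invariant under phases, so the distance to it satisfies the triangle
  inequality even after one of the two vectors is rotated by \<open>\<gamma>\<close>. The free phase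
  is what later produces the magnetic derivative instead of the plain one.\<close>

lemma cutoff_lipschitz:
  assumes \<epsilon>: "\<epsilon> > 0" and \<gamma>: "cmod \<gamma> = 1"
    and xy: "x \<in> nonvanishing_set n F" "y \<in> nonvanishing_set n F"
  shows "\<bar>cutoff n F S \<epsilon> x - cutoff n F S \<epsilon> y\<bar>
    \<le> cnorm n (\<lambda>p. cunit n (F x) p - \<gamma> * cunit n (F y) p) / \<epsilon>"
proof (cases "S \<inter> nonvanishing_set n F = {}")
  case True
  then show ?thesis using \<epsilon> by (simp add: cutoff_eq_0)
next
  case False
  let ?K = "unitary_orbit n F (S \<inter> nonvanishing_set n F)"
  define d where "d z = (INF k\<in>?K. cnorm n (\<lambda>p. z p - k p))" for z
  have ne: "?K \<noteq> {}" using False by (rule unitary_orbit_nonempty)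
  have step: "d a \<le> cnorm n (\<lambda>p. a p - \<gamma> * b p) + d b" if \<gamma>: "cmod \<gamma> = 1" for a b \<gamma>
  proof -
    have "d a - cnorm n (\<lambda>p. a p - \<gamma> * b p) \<le> d b"
      unfolding d_def[of b]
    proof (rule cINF_greatest[OF ne])
      fix k assume "k \<in> ?K"
      then obtain \<beta> w where k: "k = (\<lambda>p. \<beta> * cunit n (F w) p)" "cmod \<beta> = 1"
        "w \<in> S \<inter> nonvanishing_set n F"
        by (auto simp: unitary_orbit_def)
      have "(\<lambda>p. \<gamma> * k p) = (\<lambda>p. (\<gamma> * \<beta>) * cunit n (F w) p)" "cmod (\<gamma> * \<beta>) = 1"
        using \<gamma> k by (simp_all add: mult.assoc norm_mult)
      then have "(\<lambda>p. \<gamma> * k p) \<in> ?K"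
        using k(3) unfolding unitary_orbit_def by blast
      then have "d a \<le> cnorm n (\<lambda>p. a p - \<gamma> * k p)"
        unfolding d_def by (intro cINF_lower bdd_belowI[of _ 0]) auto
      also have "\<dots> \<le> cnorm n (\<lambda>p. a p - \<gamma> * b p) + cnorm n (\<lambda>p. \<gamma> * (b p - k p))"
        using cnorm_diff_triangle[of n a "\<lambda>p. \<gamma> * k p" "\<lambda>p. \<gamma> * b p"] by (simp add: algebra_simps)
      also have "cnorm n (\<lambda>p. \<gamma> * (b p - k p)) = cnorm n (\<lambda>p. b p - k p)"
        by (simp only: cnorm_mult \<gamma>)
      finally show "d a - cnorm n (\<lambda>p. a p - \<gamma> * b p) \<le> cnorm n (\<lambda>p. b p - k p)" by simp
    qed
    then show ?thesis by simp
  qed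
  let ?a = "cunit n (F x)" and ?b = "cunit n (F y)"
  have g: "\<gamma> * cnj \<gamma> = 1" using \<gamma> by (simp add: complex_norm_square[symmetric])
  \<comment> \<open>The reverse inequality uses the inverse phase \<open>cnj \<gamma>\<close>;
    multiplying by \<open>\<gamma>\<close> brings it back to the same norm.\<close>
  have "cnorm n (\<lambda>p. ?b p - cnj \<gamma> * ?a p) = cmod \<gamma> * cnorm n (\<lambda>p. ?b p - cnj \<gamma> * ?a p)"
    using \<gamma> by simp
  also have "\<dots> = cnorm n (\<lambda>p. \<gamma> * ?b p - (\<gamma> * cnj \<gamma>) * ?a p)"
    by (simp only: cnorm_mult[symmetric] right_diff_distrib mult.assoc)
  also have "\<dots> = cnorm n (\<lambda>p. ?a p - \<gamma> * ?b p)"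
    by (simp only: g mult_1 cnorm_minus_commute)
  finally have "d ?b \<le> cnorm n (\<lambda>p. ?a p - \<gamma> * ?b p) + d ?a"
    using step[of "cnj \<gamma>" ?b ?a] \<gamma> by simp
  moreover have "d ?a \<le> cnorm n (\<lambda>p. ?a p - \<gamma> * ?b p) + d ?b"
    by (rule step[OF \<gamma>])
  ultimately have "\<bar>d ?a - d ?b\<bar> \<le> cnorm n (\<lambda>p. ?a p - \<gamma> * ?b p)"
    by linarith
  then have "\<bar>d ?a / \<epsilon> - d ?b / \<epsilon>\<bar> \<le> cnorm n (\<lambda>p. ?a p - \<gamma> * ?b p) / \<epsilon>"
    using \<epsilon> by (simp add: diff_divide_distrib[symmetric] abs_divide divide_right_mono)
  then show ?thesis
    using xy False by (simp add: cutoff_eq_orbit_distance d_def[symmetric])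
qed

text \<open>Bolzano-Weierstrass for complex n-space in its encoding by functions: only the
  coordinates in \<open>{1..n}\<close> are bounded, and only these converge.\<close>

lemma bounded_components_convergent_subsequence:
  fixes z :: "nat \<Rightarrow> nat \<Rightarrow> complex"
  assumes "\<And>m p. p \<in> {1..n} \<Longrightarrow> cmod (z m p) \<le> B"
  obtains l r where "strict_mono (r :: nat \<Rightarrow> nat)" "\<And>p. p \<in> {1..n} \<Longrightarrow> (\<lambda>m. z (r m) p) \<longlonglongrightarrow> l p"
proof -
  have "\<forall>\<delta>\<subseteq>{1..n}. \<exists>l r. strict_mono (r :: nat \<Rightarrow> nat) \<and>
      (\<forall>e>0. eventually (\<lambda>m. \<forall>i\<in>\<delta>. dist (z (r m) i) (l i) < e) sequentially)"
    by (rule compact_lemma_general[where proj = "\<lambda>x k. x k" and unproj = "\<lambda>x. x"])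
      (auto simp: bounded_iff intro!: exI[of _ B] assms)
  then obtain l r where "strict_mono (r :: nat \<Rightarrow> nat)"
    "\<forall>e>0. eventually (\<lambda>m. \<forall>i\<in>{1..n}. dist (z (r m) i) (l i) < e) sequentially"
    by blast
  then show thesis
    by (intro that[of r l]) (auto simp: tendsto_iff elim!: eventually_mono)
qed

lemma tendsto_cnorm_diff:
  assumes "\<And>p. p \<in> {1..n} \<Longrightarrow> ((\<lambda>m. z m p) \<longlongrightarrow> l p) G"
  shows "((\<lambda>m. cnorm n (\<lambda>p. a p - z m p)) \<longlongrightarrow> cnorm n (\<lambda>p. a p - l p)) G"
  unfolding cnorm_def L2_set_def by (intro tendsto_intros assms)

text \<open>
  The orbit is in general not closed, so the nearest point \<open>k\<close> only lies in its closure.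
\<close>

lemma cutoff_touching_cone:
  assumes \<epsilon>: "\<epsilon> > 0" and x: "x \<in> nonvanishing_set n F" and pos: "cutoff n F S \<epsilon> x > 0"
  obtains k where "cutoff n F S \<epsilon> x = 1 - cnorm n (\<lambda>p. cunit n (F x) p - k p) / \<epsilon>"
    and "\<And>y. y \<in> nonvanishing_set n F \<Longrightarrow>
           1 - cnorm n (\<lambda>p. cunit n (F y) p - k p) / \<epsilon> \<le> cutoff n F S \<epsilon> y"
proof -
  have T: "S \<inter> nonvanishing_set n F \<noteq> {}" using cutoff_eq_0[of S n F \<epsilon> x] \<epsilon> pos by auto
  let ?K = "unitary_orbit n F (S \<inter> nonvanishing_set n F)"
  define d where "d y = (INF k\<in>?K. cnorm n (\<lambda>p. cunit n (F y) p - k p))" for y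
  have cut: "cutoff n F S \<epsilon> y = max 0 (1 - d y / \<epsilon>)" if "y \<in> nonvanishing_set n F" for y
    using that T by (simp add: cutoff_eq_orbit_distance d_def)
  have ne: "?K \<noteq> {}" using T by (rule unitary_orbit_nonempty)
  have bdd: "bdd_below ((\<lambda>k. cnorm n (\<lambda>p. cunit n (F y) p - k p)) ` ?K)" for y
    by (rule bdd_belowI[of _ 0]) auto
  \<comment> \<open>A minimising sequence in the orbit; its vectors have norm 1, so a subsequence
    converges to the point \<open>k\<close>.\<close>
  have "\<exists>k\<in>?K. cnorm n (\<lambda>p. cunit n (F x) p - k p) < d x + inverse (real (Suc m))" for m
    using cINF_less_iff[OF ne bdd, of x "d x + inverse (real (Suc m))"] by (simp add: d_def)
  then obtain z where z: "\<And>m. z m \<in> ?K"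
    "\<And>m. cnorm n (\<lambda>p. cunit n (F x) p - z m p) < d x + inverse (real (Suc m))"
    by metis
  have "cmod (z m p) \<le> 1" if "p \<in> {1..n}" for m p
  proof -
    obtain \<gamma> y where y: "z m = (\<lambda>p. \<gamma> * cunit n (F y) p)" "cmod \<gamma> = 1" "y \<in> nonvanishing_set n F"
      using z(1)[of m] by (auto simp: unitary_orbit_def)
    then have "cnorm n (z m) = 1"
      by (simp add: cnorm_mult cnorm_cunit nonvanishing_set_iff)
    then show ?thesis using cmod_le_cnorm[OF that, of "z m"] by simp
  qed
  then obtain k r where r: "strict_mono (r :: nat \<Rightarrow> nat)"
    and k: "\<And>p. p \<in> {1..n} \<Longrightarrow> (\<lambda>m. z (r m) p) \<longlonglongrightarrow> k p"
    using bounded_components_convergent_subsequence[of n z 1] by metis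
  have lim: "(\<lambda>m. cnorm n (\<lambda>p. cunit n (F y) p - z (r m) p)) \<longlonglongrightarrow> cnorm n (\<lambda>p. cunit n (F y) p - k p)" for y
    by (rule tendsto_cnorm_diff[OF k])
  \<comment> \<open>As a limit of orbit points, \<open>k\<close> is at least as far from every
    vector as the orbit is. Only at \<open>x\<close> is equality needed.\<close>
  have le: "d y \<le> cnorm n (\<lambda>p. cunit n (F y) p - k p)" for y
  proof (rule LIMSEQ_le_const[OF lim], intro exI allI impI)
    fix m show "d y \<le> cnorm n (\<lambda>p. cunit n (F y) p - z (r m) p)"
      unfolding d_def by (rule cINF_lower[OF bdd z(1)])
  qed
  have "(\<lambda>m. inverse (real (Suc (r m)))) \<longlonglongrightarrow> 0"
    using LIMSEQ_subseq_LIMSEQ[OF LIMSEQ_inverse_real_of_nat r] by (simp add: o_def)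
  then have "(\<lambda>m. d x + inverse (real (Suc (r m)))) \<longlonglongrightarrow> d x"
    by (auto intro: tendsto_eq_intros)
  then have "cnorm n (\<lambda>p. cunit n (F x) p - k p) \<le> d x"
    using z(2) by (intro LIMSEQ_le[OF lim]) (auto intro: less_imp_le)
  then have eq: "d x = cnorm n (\<lambda>p. cunit n (F x) p - k p)" using le[of x] by simp
  show thesis
  proof (rule that[of k])
    show "cutoff n F S \<epsilon> x = 1 - cnorm n (\<lambda>p. cunit n (F x) p - k p) / \<epsilon>"
      \<comment> \<open>Positivity excludes the value 0 of the maximum at \<open>x\<close>.\<close>
      using pos cut[OF x] by (simp add: eq max_def split: if_splits)
    fix y assume "y \<in> nonvanishing_set n F"
    then show "1 - cnorm n (\<lambda>p. cunit n (F y) p - k p) / \<epsilon> \<le> cutoff n F S \<epsilon> y"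
      using cut[of y] divide_right_mono[OF le[of y], of \<epsilon>] \<epsilon> by simp
  qed
qed

section \<open>Regularity of the norm and of the cut-off along differentiable maps\<close>

lemma differentiable_imp_pointwise_lipschitz:
  fixes f :: "'a::real_normed_vector \<Rightarrow> 'b::real_normed_vector"
  assumes "f differentiable (at x)"
  shows "\<exists>L. \<forall>\<^sub>F y in at x. norm (f y - f x) \<le> L * dist x y"
proof -
  obtain f' where f': "(f has_derivative f') (at x)"
    using assms by (auto simp: differentiable_def)
  then have bl: "bounded_linear f'" by (rule has_derivative_bounded_linear)
  obtain d where d: "d > 0"
    "\<And>y. norm (y - x) < d \<Longrightarrow> norm (f y - f x - f' (y - x)) \<le> 1 * norm (y - x)"
    using f' zero_less_one unfolding has_derivative_at_alt by blast
  have "norm (f y - f x) \<le> (1 + onorm f') * dist x y" if y: "dist y x < d" for y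
    using d(2)[of y] y onorm[OF bl, of "y - x"] norm_triangle_ineq[of "f y - f x - f' (y - x)" "f' (y - x)"]
    by (simp add: dist_norm norm_minus_commute algebra_simps)
  then show ?thesis
    using d(1) by (auto simp: eventually_at)
qed

lemma differentiable_imp_cnorm_lipschitz:
  fixes f :: "'a::real_normed_vector \<Rightarrow> nat \<Rightarrow> complex"
  assumes "\<And>p. p \<in> {1..n} \<Longrightarrow> (\<lambda>y. f y p) differentiable (at x)"
  shows "\<exists>L. \<forall>\<^sub>F y in at x. cnorm n (\<lambda>p. f y p - f x p) \<le> L * dist x y"
proof -
  have "\<forall>p\<in>{1..n}. \<exists>L. \<forall>\<^sub>F y in at x. cmod (f y p - f x p) \<le> L * dist x y"
    using differentiable_imp_pointwise_lipschitz[OF assms] by blast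
  then obtain L where "\<forall>p\<in>{1..n}. \<forall>\<^sub>F y in at x. cmod (f y p - f x p) \<le> L p * dist x y"
    by metis
  then have "\<forall>\<^sub>F y in at x. \<forall>p\<in>{1..n}. cmod (f y p - f x p) \<le> L p * dist x y"
    by (intro eventually_ball_finite) auto
  then have "\<forall>\<^sub>F y in at x. cnorm n (\<lambda>p. f y p - f x p) \<le> (\<Sum>p=1..n. L p) * dist x y"
  proof (rule eventually_mono)
    fix y assume y: "\<forall>p\<in>{1..n}. cmod (f y p - f x p) \<le> L p * dist x y"
    have "cnorm n (\<lambda>p. f y p - f x p) \<le> (\<Sum>p=1..n. cmod (f y p - f x p))"
      unfolding cnorm_def by (intro L2_set_le_sum) auto
    also have "\<dots> \<le> (\<Sum>p=1..n. L p * dist x y)"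
      using y by (intro sum_mono) auto
    finally show "cnorm n (\<lambda>p. f y p - f x p) \<le> (\<Sum>p=1..n. L p) * dist x y"
      by (simp add: sum_distrib_right)
  qed
  then show ?thesis by blast
qed

text \<open>The squared norm is a sum of real inner products, and the square root is differentiable
  away from 0.\<close>

lemma differentiable_cnorm:
  fixes f :: "'a::real_normed_vector \<Rightarrow> nat \<Rightarrow> complex"
  assumes "\<And>p. p \<in> {1..n} \<Longrightarrow> (\<lambda>y. f y p) differentiable (at x)" "cnorm n (f x) > 0"
  shows "(\<lambda>y. cnorm n (f y)) differentiable (at x)"
proof -
  have "(\<lambda>y. (cmod (f y p))\<^sup>2) differentiable (at x)" if p: "p \<in> {1..n}" for p
  proof -
    obtain f' where "((\<lambda>y. f y p) has_derivative f') (at x)"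
      using assms(1)[OF p] by (auto simp: differentiable_def)
    from has_derivative_inner[OF this this] show ?thesis
      by (auto simp: differentiable_def power2_norm_eq_inner)
  qed
  then have "(\<lambda>y. \<Sum>p=1..n. (cmod (f y p))\<^sup>2) differentiable (at x)"
    by (intro differentiable_sum) auto
  then obtain s' where s': "((\<lambda>y. (cnorm n (f y))\<^sup>2) has_derivative s') (at x)"
    unfolding cnorm_power2 differentiable_def by blast
  have "((\<lambda>y. sqrt ((cnorm n (f y))\<^sup>2)) has_derivative
      (\<lambda>h. s' h * (inverse (sqrt ((cnorm n (f x))\<^sup>2)) / 2))) (at x)"
    using assms(2) by (intro has_derivative_real_sqrt s') auto
  then show ?thesis
    by (auto simp: differentiable_def)
qed

lemma differentiable_cunit:
  fixes f :: "'a::real_normed_vector \<Rightarrow> nat \<Rightarrow> complex"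
  assumes "\<And>p. p \<in> {1..n} \<Longrightarrow> (\<lambda>y. f y p) differentiable (at x)" "cnorm n (f x) > 0" "p \<in> {1..n}"
  shows "(\<lambda>y. cunit n (f y) p) differentiable (at x)"
proof -
  obtain s' where "((\<lambda>y. cnorm n (f y)) has_derivative s') (at x)"
    using differentiable_cnorm[OF assms(1,2)] by (auto simp: differentiable_def)
  from has_derivative_of_real[OF this]
  have "(\<lambda>y. complex_of_real (cnorm n (f y))) differentiable (at x)"
    unfolding differentiable_def by blast
  then show ?thesis
    unfolding cunit_def using assms by (intro differentiable_divide) auto
qed

text \<open>At a zero of \<open>f\<close> the constant 0 touches the norm from below; elsewhere the
  norm is differentiable and touches itself.\<close>

lemma negligible_not_differentiable_cnorm:
  fixes f :: "'a::euclidean_space \<Rightarrow> nat \<Rightarrow> complex"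
  assumes f: "\<And>x p. x \<in> U \<Longrightarrow> p \<in> {1..n} \<Longrightarrow> (\<lambda>y. f y p) differentiable (at x)"
  shows "negligible {x\<in>U. \<not> (\<lambda>y. cnorm n (f y)) differentiable (at x)}"
proof (rule negligible_not_differentiable_touched_below)
  fix x assume x: "x \<in> U"
  obtain L where "\<forall>\<^sub>F y in at x. cnorm n (\<lambda>p. f y p - f x p) \<le> L * dist x y"
    using differentiable_imp_cnorm_lipschitz[of n f x] f[OF x] by blast
  then show "\<exists>L. \<forall>\<^sub>F y in at x. \<bar>cnorm n (f y) - cnorm n (f x)\<bar> \<le> L * dist x y"
    by (intro exI[of _ L], elim eventually_mono) (rule order_trans[OF cnorm_reverse_triangle])
  show "\<exists>\<phi>. \<phi> differentiable (at x) \<and> \<phi> x = cnorm n (f x) \<and> (\<forall>\<^sub>F y in at x. \<phi> y \<le> cnorm n (f y))"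
  proof (cases "cnorm n (f x) = 0")
    case True
    then show ?thesis by (intro exI[of _ "\<lambda>_. 0"]) simp
  next
    case False
    then have "cnorm n (f x) > 0" by (simp add: less_le)
    then show ?thesis using differentiable_cnorm[of n f x] f[OF x] by (intro exI[of _ "\<lambda>y. cnorm n (f y)"]) simp
  qed
qed

text \<open>The map \<open>h\<close> stands for the inverse of a chart, so that null sets are taken
  in Euclidean space while the cut-off is defined on the manifold. The phase 1 suffices for the
  pointwise Lipschitz bound.\<close>

lemma negligible_not_differentiable_cutoff:
  fixes h :: "'a::euclidean_space \<Rightarrow> 'm"
  assumes F: "\<And>x p. x \<in> U \<Longrightarrow> p \<in> {1..n} \<Longrightarrow> (\<lambda>y. F (h y) p) differentiable (at x)"
    and \<epsilon>: "\<epsilon> > 0"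
  shows "negligible {x\<in>U. h x \<in> nonvanishing_set n F \<and>
           \<not> (\<lambda>y. cutoff n F S \<epsilon> (h y)) differentiable (at x)}"
proof -
  let ?V = "{x\<in>U. h x \<in> nonvanishing_set n F}"
  have "negligible {x\<in>?V. \<not> (\<lambda>y. cutoff n F S \<epsilon> (h y)) differentiable (at x)}"
  proof (rule negligible_not_differentiable_touched)
    fix x assume "x \<in> ?V"
    then have x: "x \<in> U" "h x \<in> nonvanishing_set n F" "cnorm n (F (h x)) > 0"
      by (auto simp: nonvanishing_set_iff)
    have "isCont (\<lambda>y. cnorm n (F (h y))) x"
      using differentiable_cnorm[of n "\<lambda>y. F (h y)" x] F[OF x(1)] x(3)
      by (intro differentiable_imp_continuous_within) auto
    \<comment> \<open>The Lipschitz bound and the touching cone are only available where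
      \<open>F\<close> does not vanish; by continuity this holds near \<open>x\<close>.\<close>
    then have nz: "\<forall>\<^sub>F y in at x. h y \<in> nonvanishing_set n F"
      unfolding nonvanishing_set_iff using x(3) by (intro order_tendstoD(1)) (auto simp: isCont_def)
    obtain L where L: "\<forall>\<^sub>F y in at x. cnorm n (\<lambda>p. F (h y) p - F (h x) p) \<le> L * dist x y"
      using differentiable_imp_cnorm_lipschitz[of n "\<lambda>y. F (h y)" x] F[OF x(1)] by blast
    let ?C = "2 / cnorm n (F (h x)) / \<epsilon>"
    have C: "0 \<le> ?C" using \<epsilon> x(3) by simp
    have "\<forall>\<^sub>F y in at x. \<bar>cutoff n F S \<epsilon> (h y) - cutoff n F S \<epsilon> (h x)\<bar> \<le> ?C * L * dist x y"
      using nz L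
    proof (rule eventually_elim2)
      fix y assume y: "h y \<in> nonvanishing_set n F" "cnorm n (\<lambda>p. F (h y) p - F (h x) p) \<le> L * dist x y"
      have "\<bar>cutoff n F S \<epsilon> (h y) - cutoff n F S \<epsilon> (h x)\<bar>
          \<le> cnorm n (\<lambda>p. cunit n (F (h x)) p - cunit n (F (h y)) p) / \<epsilon>"
        using cutoff_lipschitz[OF \<epsilon> norm_one x(2) y(1), of S] by (simp add: abs_minus_commute)
      also have "\<dots> \<le> (2 * cnorm n (\<lambda>p. F (h x) p - F (h y) p) / cnorm n (F (h x))) / \<epsilon>"
        using \<epsilon> x(3) y(1) by (intro divide_right_mono cnorm_cunit_diff_le) (auto simp: nonvanishing_set_iff)
      also have "\<dots> = ?C * cnorm n (\<lambda>p. F (h y) p - F (h x) p)"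
        using cnorm_minus_commute[of n "F (h x)" "F (h y)"] by simp
      also have "\<dots> \<le> ?C * (L * dist x y)"
        by (rule mult_left_mono[OF y(2) C])
      finally show "\<bar>cutoff n F S \<epsilon> (h y) - cutoff n F S \<epsilon> (h x)\<bar> \<le> ?C * L * dist x y"
        by (simp only: mult.assoc)
    qed
    then show "\<exists>L. \<forall>\<^sub>F y in at x. \<bar>cutoff n F S \<epsilon> (h y) - cutoff n F S \<epsilon> (h x)\<bar> \<le> L * dist x y"
      by blast
    show "\<exists>\<phi>. \<phi> differentiable (at x) \<and> \<phi> x = cutoff n F S \<epsilon> (h x) \<and>
        ((\<forall>\<^sub>F y in at x. \<phi> y \<le> cutoff n F S \<epsilon> (h y)) \<or> (\<forall>\<^sub>F y in at x. cutoff n F S \<epsilon> (h y) \<le> \<phi> y))"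
    proof -
      consider "cutoff n F S \<epsilon> (h x) = 0" | "cutoff n F S \<epsilon> (h x) = 1"
        | "0 < cutoff n F S \<epsilon> (h x)" "cutoff n F S \<epsilon> (h x) < 1"
        using cutoff_bounds[OF \<epsilon>, of n F S "h x"] by linarith
      then show ?thesis
      proof cases
        case 1
        then show ?thesis by (intro exI[of _ "\<lambda>_. 0"]) (simp add: cutoff_bounds[OF \<epsilon>])
      next
        case 2
        then show ?thesis by (intro exI[of _ "\<lambda>_. 1"]) (simp add: cutoff_bounds[OF \<epsilon>])
      next
        case 3
        obtain k where k: "cutoff n F S \<epsilon> (h x) = 1 - cnorm n (\<lambda>p. cunit n (F (h x)) p - k p) / \<epsilon>"
          "\<And>y. y \<in> nonvanishing_set n F \<Longrightarrow>
             1 - cnorm n (\<lambda>p. cunit n (F y) p - k p) / \<epsilon> \<le> cutoff n F S \<epsilon> y"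
          using cutoff_touching_cone[OF \<epsilon> x(2) 3(1)] by blast
        let ?\<phi> = "\<lambda>y. 1 - cnorm n (\<lambda>p. cunit n (F (h y)) p - k p) / \<epsilon>"
        \<comment> \<open>A cut-off value below 1 keeps the point away from the tip \<open>k\<close>
          of the cone, where the norm need not be differentiable.\<close>
        have "cnorm n (\<lambda>p. cunit n (F (h x)) p - k p) > 0"
          using 3(2) k(1) \<epsilon> by (simp add: zero_less_divide_iff)
        moreover have "(\<lambda>y. cunit n (F (h y)) p - k p) differentiable (at x)" if "p \<in> {1..n}" for p
          using F[OF x(1)] x(3) that by (intro differentiable_diff differentiable_cunit) auto
        ultimately have "(\<lambda>y. cnorm n (\<lambda>p. cunit n (F (h y)) p - k p)) differentiable (at x)"
          by (intro differentiable_cnorm) auto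
        then have "?\<phi> differentiable (at x)"
          using \<epsilon> by (intro differentiable_diff differentiable_divide) auto
        moreover have "\<forall>\<^sub>F y in at x. ?\<phi> y \<le> cutoff n F S \<epsilon> (h y)"
          using nz by (rule eventually_mono) (rule k(2))
        ultimately show ?thesis using k(1) by (intro exI[of _ ?\<phi>]) auto
      qed
    qed
  qed
  then show ?thesis by (simp add: conj_assoc)
qed

section \<open>Charts and null sets\<close>

lemma smooth_on_differentiable: "smooth_on S f \<Longrightarrow> x \<in> S \<Longrightarrow> f differentiable (at x)"
  unfolding smooth_on_def by (metis Ck_on.simps(2))

lemma chart_inverse:
  assumes "is_chart c"
  shows "x \<in> chart_dom c \<Longrightarrow> chart_inv c (chart_map c x) = x"
    and "y \<in> chart_img c \<Longrightarrow> chart_map c (chart_inv c y) = y"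
    and "y \<in> chart_img c \<Longrightarrow> chart_inv c y \<in> chart_dom c"
  using inv_into_f_f[OF inj_on_chart_map[OF assms], of x] f_inv_into_f[of y "chart_map c" "chart_dom c"]
    inv_into_into[of y "chart_map c" "chart_dom c"] by auto

text \<open>One chart suffices, because the transition maps are differentiable.\<close>

lemma differentiable_at_pointI:
  assumes A: "smooth_atlas A" and c: "c \<in> A" "x \<in> chart_dom c"
    and u: "(u \<circ> chart_inv c) differentiable (at (chart_map c x))"
  shows "differentiable_at_point A u x"
  unfolding differentiable_at_point_def
proof (intro ballI impI)
  fix d assume d: "d \<in> A" "x \<in> chart_dom d"
  have ch: "is_chart c" "is_chart d" using A c d by (auto simp: smooth_atlas_def)
  let ?W = "chart_img d \<inter> chart_inv d -` chart_dom c"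
  have "continuous_on (chart_img d) (chart_inv d)" "open (chart_img d)" "open (chart_dom c)"
    using ch by (auto simp: is_chart_def homeomorphism_def)
  then have W: "open ?W" by (rule continuous_open_preimage)
  have xW: "chart_map d x \<in> ?W" using c d ch by (simp add: chart_inverse)
  have "smooth_on (chart_map d ` (chart_dom d \<inter> chart_dom c)) (chart_map c \<circ> chart_inv d)"
    using A c d by (simp add: smooth_atlas_def)
  then have "(chart_map c \<circ> chart_inv d) differentiable (at (chart_map d x))"
    using c d by (intro smooth_on_differentiable) auto
  moreover have "(u \<circ> chart_inv c) differentiable (at ((chart_map c \<circ> chart_inv d) (chart_map d x)))"
    using u d ch by (simp add: chart_inverse)
  ultimately have "((u \<circ> chart_inv c) \<circ> (chart_map c \<circ> chart_inv d)) differentiable (at (chart_map d x))"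
    by (rule differentiable_chain_at)
  then obtain D where "(((u \<circ> chart_inv c) \<circ> (chart_map c \<circ> chart_inv d)) has_derivative D) (at (chart_map d x))"
    by (auto simp: differentiable_def)
  \<comment> \<open>The composite agrees with \<open>u \<circ> chart_inv d\<close> only where the
    two charts overlap, an open set around the point.\<close>
  then have "((u \<circ> chart_inv d) has_derivative D) (at (chart_map d x))"
    using W xW by (rule has_derivative_transform_within_open) (simp add: ch chart_inverse)
  then show "(u \<circ> chart_inv d) differentiable (at (chart_map d x))"
    by (auto simp: differentiable_def)
qed

text \<open>The exceptional set need not be Borel. Its image in each chart of the cover is enlarged
  to a Borel null set, and the preimages are glued along the disjoint pieces that define the volume.
  In coordinates, the volume of the result is an integral over null sets.\<close>

lemma AE_riemannian_volumeI:
  fixes A :: "('m::second_countable_topology, 'd::finite) chart set"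
  assumes A: "smooth_atlas A" and g: "riemannian_metric A g"
    and P: "\<And>c. c \<in> A \<Longrightarrow> negligible (chart_map c ` {x\<in>chart_dom c. \<not> P x})"
  shows "AE x in riemannian_volume A g. P x"
proof -
  let ?c = "chart_cover A" and ?D = "disjointed (\<lambda>j. chart_dom (chart_cover A j))"
  have cA: "?c i \<in> A" for i using chart_cover_atlas A by blast
  have ch: "is_chart (?c i)" for i using cA A by (auto simp: smooth_atlas_def)
  have op: "chart_dom (?c i) \<in> sets borel" for i using ch[of i] by (simp add: is_chart_def)
  have D: "?D i \<in> sets borel" "?D i \<subseteq> chart_dom (?c i)" for i
    using op by (auto simp: disjointed_def intro!: sets.Diff sets.finite_UN)
  have "\<exists>N\<in>null_sets lborel. chart_map (?c i) ` {x\<in>chart_dom (?c i). \<not> P x} \<subseteq> N" for i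
    using P[OF cA[of i]] by (simp add: negligible_iff_null_sets null_sets_completion_iff2)
  then obtain N where N: "\<And>i. N i \<in> null_sets lborel"
    "\<And>i. chart_map (?c i) ` {x\<in>chart_dom (?c i). \<not> P x} \<subseteq> N i"
    by metis
  have N_borel: "N i \<in> sets borel" for i using N(1)[of i] by auto
  define B where "B = (\<Union>i. ?D i \<inter> (chart_map (?c i) -` N i \<inter> chart_dom (?c i)))"
  have "chart_map (?c i) -` N i \<inter> chart_dom (?c i) \<in> sets borel" for i
  proof -
    have "continuous_on (chart_dom (?c i)) (chart_map (?c i))"
      using ch[of i] by (auto simp: is_chart_def homeomorphism_def)
    then have "chart_map (?c i) \<in> measurable (restrict_space borel (chart_dom (?c i))) borel"
      by (rule borel_measurable_continuous_on_restrict)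
    from measurable_sets[OF this N_borel[of i]] show ?thesis
      using op by (simp add: sets_restrict_space_iff space_restrict_space)
  qed
  then have B: "B \<in> sets borel"
    using D(1) unfolding B_def by (intro sets.countable_UN sets.Int) auto
  have "chart_volume g (?c i) (B \<inter> ?D i) = 0" for i
  proof -
    have "chart_map (?c i) ` (B \<inter> ?D i) \<subseteq> N i"
    proof
      fix y assume "y \<in> chart_map (?c i) ` (B \<inter> ?D i)"
      then obtain x j where x: "y = chart_map (?c i) x" "x \<in> ?D i" "x \<in> ?D j" "chart_map (?c j) x \<in> N j"
        by (auto simp: B_def)
      \<comment> \<open>The pieces are disjoint, so only the chart with index \<open>i\<close>
        contributes to the part of \<open>B\<close> in the piece \<open>i\<close>.\<close>
      then have "i = j"
        using disjoint_family_disjointed[of "\<lambda>j. chart_dom (?c j)"] by (auto simp: disjoint_family_on_def)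
      with x show "y \<in> N i" by simp
    qed
    then have "AE y in lborel. ennreal (sqrt (det (g (?c i) (chart_inv (?c i) y))))
        * indicator (chart_map (?c i) ` (B \<inter> ?D i)) y = 0"
      using AE_not_in[OF N(1)[of i]] by (auto elim!: eventually_mono simp: indicator_def)
    then have "chart_volume g (?c i) (B \<inter> ?D i) = (\<integral>\<^sup>+y. 0 \<partial>(lborel :: (real^'d) measure))"
      unfolding chart_volume_def by (rule nn_integral_cong_AE)
    then show ?thesis by simp
  qed
  then have "emeasure (riemannian_volume A g) B = 0"
    using emeasure_riemannian_volume[OF A g B] by simp
  then have "B \<in> null_sets (riemannian_volume A g)"
    using B by (auto simp: riemannian_volume_def sigma_algebra.sets_measure_of_eq[OF sets.sigma_algebra_axioms[of borel, simplified]])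
  moreover have "{x\<in>space (riemannian_volume A g). \<not> P x} \<subseteq> B"
  proof
    fix x assume x: "x \<in> {x\<in>space (riemannian_volume A g). \<not> P x}"
    have "x \<in> (\<Union>i. ?D i)"
      using chart_cover_atlas(2)[OF A] by (simp add: UN_disjointed_eq)
    then obtain i where i: "x \<in> ?D i" by blast
    then have "x \<in> chart_dom (?c i)" using D(2) by blast
    moreover have "chart_map (?c i) x \<in> N i" using x N(2)[of i] calculation by blast
    ultimately show "x \<in> B" using i unfolding B_def by blast
  qed
  ultimately show ?thesis by (rule AE_I')
qed

text \<open>The condition in the \<open>if\<close> concerns the fixed point \<open>x\<close>, not
  the argument of the function. At a zero of \<open>F\<close> the cut-off may be discontinuous, so
  there only the norm of \<open>F\<close> is asked to be differentiable.\<close>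

lemma AE_cutoff_regular:
  fixes A :: "('m::second_countable_topology, 'd::finite) chart set"
  assumes A: "smooth_atlas A" and g: "riemannian_metric A g" and \<epsilon>: "\<epsilon> > 0"
    and F: "\<And>p. p \<in> {1..n} \<Longrightarrow> smooth_fun A (\<lambda>x. F x p)"
  shows "AE x in riemannian_volume A g.
    differentiable_at_point A (if x \<in> nonvanishing_set n F then cutoff n F S \<epsilon> else (\<lambda>y. cnorm n (F y))) x"
    (is "AE x in _. ?P x")
proof (rule AE_riemannian_volumeI[OF A g])
  fix c assume c: "c \<in> A"
  then have ch: "is_chart c" using A by (auto simp: smooth_atlas_def)
  have d: "(\<lambda>y. F (chart_inv c y) p) differentiable (at x)" if "x \<in> chart_img c" "p \<in> {1..n}" for x p
  proof -
    have "smooth_on (chart_img c) ((\<lambda>x. F x p) \<circ> chart_inv c)"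
      using F[OF that(2)] c unfolding smooth_fun_def by blast
    from smooth_on_differentiable[OF this that(1)] show ?thesis by (simp add: o_def)
  qed
  have "negligible ({x\<in>chart_img c. chart_inv c x \<in> nonvanishing_set n F \<and>
          \<not> (\<lambda>y. cutoff n F S \<epsilon> (chart_inv c y)) differentiable (at x)} \<union>
        {x\<in>chart_img c. \<not> (\<lambda>y. cnorm n (F (chart_inv c y))) differentiable (at x)})" (is "negligible ?N")
    using d \<epsilon> by (intro negligible_Un negligible_not_differentiable_cutoff negligible_not_differentiable_cnorm) auto
  moreover have "chart_map c ` {x\<in>chart_dom c. \<not> ?P x} \<subseteq> ?N"
  proof
    fix z assume "z \<in> chart_map c ` {x\<in>chart_dom c. \<not> ?P x}"
    then obtain x where z: "z = chart_map c x" and x: "x \<in> chart_dom c" "\<not> ?P x" by blast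
    have "\<not> ((if x \<in> nonvanishing_set n F then cutoff n F S \<epsilon> else (\<lambda>y. cnorm n (F y))) \<circ> chart_inv c)
        differentiable (at (chart_map c x))"
      using differentiable_at_pointI[OF A c x(1)] x(2) by blast
    then show "z \<in> ?N"
      using x(1) ch by (auto simp: z chart_inverse o_def split: if_splits)
  qed
  ultimately show "negligible (chart_map c ` {x\<in>chart_dom c. \<not> ?P x})"
    by (rule negligible_subset)
qed

section \<open>The energy estimate\<close>

lemma linear_axis_expansion:
  fixes T :: "real^'d \<Rightarrow> 'b::real_vector"
  assumes "linear T"
  shows "T v = (\<Sum>j\<in>UNIV. v $ j *\<^sub>R T (axis j 1))"
proof -
  have "T v = T (\<Sum>j\<in>UNIV. v $ j *\<^sub>R axis j 1)"
    using basis_expansion[of v] by (simp add: scalar_mult_eq_scaleR)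
  then show ?thesis
    using assms by (simp add: linear_sum linear_cmul)
qed

lemma has_derivative_imp_difference_quotient:
  fixes f :: "real \<Rightarrow> 'b::real_normed_vector"
  assumes "(f has_derivative (\<lambda>t. t *\<^sub>R d)) (at 0)"
  shows "((\<lambda>t. (f t - f 0) /\<^sub>R t) \<longlongrightarrow> d) (at 0)"
proof -
  have "((\<lambda>t. norm (f t - f 0 - t *\<^sub>R d) / norm t) \<longlongrightarrow> 0) (at 0)"
    using assms unfolding has_derivative_at by simp
  then have "((\<lambda>t. norm ((f t - f 0) /\<^sub>R t - d)) \<longlongrightarrow> 0) (at 0)"
  proof (rule Lim_transform_eventually)
    have "norm (f t - f 0 - t *\<^sub>R d) / norm t = norm ((f t - f 0) /\<^sub>R t - d)" if "t \<noteq> 0" for t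
    proof -
      have "(f t - f 0) /\<^sub>R t - d = (f t - f 0 - t *\<^sub>R d) /\<^sub>R t"
        using that by (simp add: scaleR_diff_right)
      then show ?thesis by (simp add: divide_inverse mult.commute)
    qed
    then show "\<forall>\<^sub>F t in at 0. norm (f t - f 0 - t *\<^sub>R d) / norm t = norm ((f t - f 0) /\<^sub>R t - d)"
      by (auto simp: eventually_at intro!: exI[of _ 1])
  qed
  then show ?thesis
    by (simp only: tendsto_norm_zero_iff LIM_zero_iff)
qed

section \<open>Complex covectors and the inverse of the metric\<close>

definition covector_square :: "real^'d^'d \<Rightarrow> complex^'d::finite \<Rightarrow> real" where
  "covector_square Q \<zeta> =
     Re (\<Sum>i\<in>UNIV. \<Sum>j\<in>UNIV. of_real (Q $ i $ j) * \<zeta> $ i * cnj (\<zeta> $ j))"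

text \<open>Real and imaginary parts decouple once the real part is taken, so estimates for real
  covectors carry over to complex ones.\<close>

lemma covector_square_eq:
  "covector_square Q \<zeta> = (\<chi> i. Re (\<zeta> $ i)) \<bullet> (Q *v (\<chi> i. Re (\<zeta> $ i))) + (\<chi> i. Im (\<zeta> $ i)) \<bullet> (Q *v (\<chi> i. Im (\<zeta> $ i)))"
  by (simp add: covector_square_def inner_vec_def matrix_vector_mult_def sum_distrib_left
      sum.distrib[symmetric] algebra_simps)

context
  fixes G :: "real^'d^'d::finite"
  assumes sym: "transpose G = G" and pos: "\<And>v. v \<noteq> 0 \<Longrightarrow> v \<bullet> (G *v v) > 0"
begin

lemma inner_symmetric_matrix: "(G *v v) \<bullet> w = v \<bullet> (G *v w)"
  using dot_lmul_matrix[of v G w] sym by (metis transpose_matrix_vector)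

lemma positive_definite_matrix_inv: "G *v (matrix_inv G *v a) = a"
proof -
  have "\<forall>v. G *v v = 0 \<longrightarrow> v = 0" using pos by force
  then have "invertible G"
    by (simp add: invertible_left_inverse matrix_left_invertible_ker)
  then have "G ** matrix_inv G = mat 1"
    unfolding invertible_def matrix_inv_def by (rule someI2_ex) simp
  then show ?thesis by (simp add: matrix_vector_mul_assoc)
qed

lemma matrix_inv_quadratic: "a \<bullet> (matrix_inv G *v a) = (matrix_inv G *v a) \<bullet> (G *v (matrix_inv G *v a))"
  by (simp add: positive_definite_matrix_inv inner_commute)

lemma matrix_inv_quadratic_nonneg: "0 \<le> a \<bullet> (matrix_inv G *v a)"
  unfolding matrix_inv_quadratic using pos by (cases "matrix_inv G *v a = 0") (auto intro: less_imp_le)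

text \<open>The covector \<open>a\<close> is represented by the vector \<open>w\<close> with
  \<open>G *v w = a\<close>; the claim is then Cauchy-Schwarz for the inner product given by
  \<open>G\<close>.\<close>

lemma covector_Cauchy_Schwarz: "(a \<bullet> v)\<^sup>2 \<le> (a \<bullet> (matrix_inv G *v a)) * (v \<bullet> (G *v v))"
proof (cases "v = 0")
  case False
  define w where "w = matrix_inv G *v a"
  have a: "a = G *v w" by (simp add: w_def positive_definite_matrix_inv)
  let ?s = "v \<bullet> (G *v v)"
  have s: "?s > 0" using pos False by simp
  \<comment> \<open>The multiple of \<open>v\<close> closest to \<open>w\<close> with respect to
    \<open>G\<close>.\<close>
  define \<tau> where "\<tau> = (a \<bullet> v) / ?s"
  have "0 \<le> (w - \<tau> *\<^sub>R v) \<bullet> (G *v (w - \<tau> *\<^sub>R v))"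
    using pos by (cases "w - \<tau> *\<^sub>R v = 0") (auto intro: less_imp_le)
  also have "\<dots> = a \<bullet> w - 2 * \<tau> * (a \<bullet> v) + \<tau>\<^sup>2 * ?s"
    using inner_symmetric_matrix[of w v] inner_symmetric_matrix[of v w]
    by (simp add: a matrix_vector_mult_diff_distrib matrix_vector_mult_scaleR inner_diff inner_commute
        power2_eq_square algebra_simps)
  also have "\<dots> = a \<bullet> w - (a \<bullet> v)\<^sup>2 / ?s"
    using s by (simp add: \<tau>_def power2_eq_square)
  finally show ?thesis
    using s by (simp add: w_def field_simps)
qed simp

lemma covector_square_nonneg: "0 \<le> covector_square (matrix_inv G) \<zeta>"
  unfolding covector_square_eq by (intro add_nonneg_nonneg matrix_inv_quadratic_nonneg)

lemma covector_square_eval: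
  "(cmod (\<Sum>j\<in>UNIV. v $ j *\<^sub>R \<zeta> $ j))\<^sup>2 \<le> covector_square (matrix_inv G) \<zeta> * (v \<bullet> (G *v v))"
proof -
  have "(cmod (\<Sum>j\<in>UNIV. v $ j *\<^sub>R \<zeta> $ j))\<^sup>2 = ((\<chi> i. Re (\<zeta> $ i)) \<bullet> v)\<^sup>2 + ((\<chi> i. Im (\<zeta> $ i)) \<bullet> v)\<^sup>2"
    by (simp add: cmod_power2 inner_vec_def mult.commute)
  then show ?thesis
    using covector_Cauchy_Schwarz[of "\<chi> i. Re (\<zeta> $ i)" v] covector_Cauchy_Schwarz[of "\<chi> i. Im (\<zeta> $ i)" v]
    by (simp add: covector_square_eq distrib_right)
qed

text \<open>The parallelogram law with one nonnegative term dropped; this is where the leading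
  factor 2 of the final estimate arises.\<close>

lemma covector_square_add:
  "covector_square (matrix_inv G) (\<zeta> + \<xi>)
    \<le> 2 * covector_square (matrix_inv G) \<zeta> + 2 * covector_square (matrix_inv G) \<xi>"
proof -
  have "covector_square (matrix_inv G) (\<zeta> + \<xi>) + covector_square (matrix_inv G) (\<zeta> - \<xi>)
      = 2 * covector_square (matrix_inv G) \<zeta> + 2 * covector_square (matrix_inv G) \<xi>"
    unfolding covector_square_def
    by (simp add: sum_distrib_left sum.distrib[symmetric] sum_subtractf[symmetric] algebra_simps)
  then show ?thesis using covector_square_nonneg[of "\<zeta> - \<xi>"] by simp
qed

end

lemma covector_square_scale:
  "covector_square Q (\<chi> j. of_real (k $ j) * z) = (k \<bullet> (Q *v k)) * (cmod z)\<^sup>2"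
  unfolding covector_square_def cmod_power2
  by (simp add: inner_vec_def matrix_vector_mult_def sum_distrib_left sum_distrib_right
      power2_eq_square algebra_simps)

lemma covector_square_scaleR: "covector_square Q (r *\<^sub>R \<zeta>) = r\<^sup>2 * covector_square Q \<zeta>"
  by (simp add: covector_square_def sum_distrib_left power2_eq_square algebra_simps)

text \<open>Here \<open>k\<close> is the differential of the cut-off, \<open>r\<close> its value,
  \<open>z\<close> the value of \<open>F\<close> and \<open>D p\<close> the magnetic differential of
  the component \<open>p\<close>. Testing the directional bound on the gradient
  \<open>matrix_inv G *v k\<close> gives a bound for the norm of \<open>k\<close>, and the Leibniz
  sum is then split by \<open>covector_square_add\<close>.\<close>

lemma leibniz_energy_bound:
  fixes G :: "real^'d^'d::finite" and D :: "nat \<Rightarrow> complex^'d"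
  assumes G: "transpose G = G" "\<And>v. v \<noteq> 0 \<Longrightarrow> v \<bullet> (G *v v) > 0"
    and r: "0 \<le> r" "r \<le> 1" and c: "0 \<le> c"
    and k: "\<And>v. (k \<bullet> v)\<^sup>2 * (cnorm n z)\<^sup>2 \<le> c * (\<Sum>p=1..n. (cmod (\<Sum>j\<in>UNIV. v $ j *\<^sub>R D p $ j))\<^sup>2)"
  shows "(\<Sum>p=1..n. covector_square (matrix_inv G) ((\<chi> j. of_real (k $ j) * z p) + r *\<^sub>R D p))
    \<le> 2 * (1 + c) * (\<Sum>p=1..n. covector_square (matrix_inv G) (D p))"
proof -
  let ?Q = "matrix_inv G" and ?q = "covector_square (matrix_inv G)"
  let ?E = "\<Sum>p=1..n. ?q (D p)" and ?\<kappa> = "k \<bullet> (matrix_inv G *v k)"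
  have E: "0 \<le> ?E" by (intro sum_nonneg covector_square_nonneg G)
  have \<kappa>: "0 \<le> ?\<kappa>" by (rule matrix_inv_quadratic_nonneg[OF G])
  have gradient: "?\<kappa> * (cnorm n z)\<^sup>2 \<le> c * ?E"
  \<comment> \<open>The gradient test yields the claim multiplied by \<open>?\<kappa>\<close>, which
    has to be cancelled.\<close>
  proof (cases "?\<kappa> = 0")
    case True
    then show ?thesis using c E by simp
  next
    case False
    let ?v = "matrix_inv G *v k"
    have "?\<kappa> * (?\<kappa> * (cnorm n z)\<^sup>2) = (k \<bullet> ?v)\<^sup>2 * (cnorm n z)\<^sup>2"
      by (simp add: power2_eq_square)
    also have "\<dots> \<le> c * (\<Sum>p=1..n. (cmod (\<Sum>j\<in>UNIV. ?v $ j *\<^sub>R D p $ j))\<^sup>2)"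
      by (rule k)
    also have "\<dots> \<le> c * (\<Sum>p=1..n. ?q (D p) * (?v \<bullet> (G *v ?v)))"
      using c by (intro mult_left_mono sum_mono covector_square_eval G)
    also have "\<dots> = ?\<kappa> * (c * ?E)"
      by (simp add: matrix_inv_quadratic[OF G, of k] sum_distrib_left algebra_simps)
    finally show ?thesis using \<kappa> False by simp
  qed
  have "(\<Sum>p=1..n. ?q ((\<chi> j. of_real (k $ j) * z p) + r *\<^sub>R D p))
      \<le> (\<Sum>p=1..n. 2 * (?\<kappa> * (cmod (z p))\<^sup>2) + 2 * (r\<^sup>2 * ?q (D p)))"
    unfolding covector_square_scale[symmetric] covector_square_scaleR[symmetric]
    by (intro sum_mono covector_square_add G)
  also have "\<dots> = 2 * (?\<kappa> * (cnorm n z)\<^sup>2) + 2 * (r\<^sup>2 * ?E)"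
    by (simp add: sum.distrib sum_distrib_left cnorm_power2)
  also have "\<dots> \<le> 2 * (c * ?E) + 2 * (1 * ?E)"
    using gradient E r by (intro add_mono mult_left_mono mult_right_mono) (auto simp: power_le_one)
  finally show ?thesis by (simp add: algebra_simps)
qed

text \<open>
  The factor \<open>exp (\<i>t\<alpha>(v))\<close> does not change \<open>dist_map\<close>, and its derivative turns the differential of \<open>F\<close>
  into the magnetic one.
\<close>

lemma cutoff_directional_derivative_le:
  fixes h :: "real^'d::finite \<Rightarrow> 'm" and a :: real
  assumes \<epsilon>: "\<epsilon> > 0" and x: "h y \<in> nonvanishing_set n F"
    and e': "((\<lambda>y. cutoff n F S \<epsilon> (h y)) has_derivative e') (at y)"
    and F': "\<And>p. p \<in> {1..n} \<Longrightarrow> ((\<lambda>y. F (h y) p) has_derivative F' p) (at y)"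
  shows "(e' v)\<^sup>2 * (cnorm n (F (h y)))\<^sup>2
    \<le> 4 / \<epsilon>\<^sup>2 * (\<Sum>p=1..n. (cmod (F' p v + \<i> * of_real a * F (h y) p))\<^sup>2)"
proof -
  let ?N = "cnorm n (F (h y))"
  have N: "?N > 0" using x by (simp add: nonvanishing_set_iff)
  define u where "u t = cutoff n F S \<epsilon> (h (y + t *\<^sub>R v))" for t
  \<comment> \<open>The values of \<open>F\<close> along the line, rotated by a phase. The
    derivative at 0 is \<open>?d\<close>, which is the magnetic derivative when \<open>a\<close> is
    the value of the potential on \<open>v\<close>.\<close>
  define b where "b t p = exp (\<i> * of_real (t * a)) * F (h (y + t *\<^sub>R v)) p" for t p
  let ?d = "\<lambda>p. F' p v + \<i> * of_real a * F (h y) p"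
  have line: "((\<lambda>t. y + t *\<^sub>R v) has_derivative (\<lambda>t. t *\<^sub>R v)) (at 0)"
    by (auto intro!: derivative_eq_intros)
  have "(u has_derivative (\<lambda>t. e' (t *\<^sub>R v))) (at 0)"
    unfolding u_def using has_derivative_compose[OF line, of "\<lambda>y. cutoff n F S \<epsilon> (h y)" e'] e' by simp
  then have "(u has_derivative (\<lambda>t. t *\<^sub>R e' v)) (at 0)"
    using linear_cmul[OF has_derivative_linear[OF e']] by simp
  then have lim_u: "((\<lambda>t. (u t - u 0) /\<^sub>R t) \<longlongrightarrow> e' v) (at 0)"
    by (rule has_derivative_imp_difference_quotient)
  have lim_b: "((\<lambda>t. (b t p - b 0 p) /\<^sub>R t) \<longlongrightarrow> ?d p) (at 0)" if p: "p \<in> {1..n}" for p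
  proof (rule has_derivative_imp_difference_quotient)
    have 1: "((\<lambda>t. F (h (y + t *\<^sub>R v)) p) has_derivative (\<lambda>t. F' p (t *\<^sub>R v))) (at 0)"
      using has_derivative_compose[OF line, of "\<lambda>y. F (h y) p" "F' p"] F'[OF p] by simp
    have 2: "((\<lambda>t. exp (\<i> * of_real (t * a))) has_derivative (\<lambda>t. t *\<^sub>R (\<i> * of_real a))) (at 0)"
    proof -
      have "bounded_linear (\<lambda>t. t *\<^sub>R (\<i> * complex_of_real a))"
        by (rule bounded_linear_scaleR_left)
      then have "((\<lambda>t. t *\<^sub>R (\<i> * complex_of_real a)) has_derivative (\<lambda>t. t *\<^sub>R (\<i> * of_real a))) (at 0)"
        by (rule bounded_linear_imp_has_derivative)
      from has_derivative_compose[OF this, of exp "(*) 1"] DERIV_exp[of "0::complex"] show ?thesis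
        by (simp add: has_field_derivative_def scaleR_conv_of_real mult.left_commute)
    qed
    have 3: "F' p (t *\<^sub>R v) = t *\<^sub>R F' p v" for t
      by (rule linear_cmul[OF has_derivative_linear[OF F'[OF p]]])
    show "((\<lambda>t. b t p) has_derivative (\<lambda>t. t *\<^sub>R ?d p)) (at 0)"
      using has_derivative_mult[OF 2 1] unfolding b_def 3
      by (simp add: scaleR_conv_of_real algebra_simps)
  qed
  have nz: "\<forall>\<^sub>F t in at 0. h (y + t *\<^sub>R v) \<in> nonvanishing_set n F"
  proof -
    have "(\<lambda>y. cnorm n (F (h y))) differentiable (at y)"
      using F' N by (intro differentiable_cnorm) (auto simp: differentiable_def)
    then have "isCont (\<lambda>y. cnorm n (F (h y))) (y + 0 *\<^sub>R v)"
      using differentiable_imp_continuous_within by auto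
    then have "isCont (\<lambda>t. cnorm n (F (h (y + t *\<^sub>R v)))) 0"
      by (rule isCont_o2[rotated]) (intro continuous_intros)
    then show ?thesis
      unfolding nonvanishing_set_iff using N by (intro order_tendstoD(1)) (auto simp: isCont_def)
  qed
  let ?C = "2 / ?N / \<epsilon>"
  have C: "0 \<le> ?C" using N \<epsilon> by simp
  have "\<forall>\<^sub>F t in at 0. \<bar>(u t - u 0) /\<^sub>R t\<bar> \<le> ?C * cnorm n (\<lambda>p. (b t p - b 0 p) /\<^sub>R t)"
    using nz
  proof (rule eventually_mono)
    fix t assume t: "h (y + t *\<^sub>R v) \<in> nonvanishing_set n F"
    let ?\<gamma> = "exp (\<i> * of_real (t * a))" and ?z = "F (h (y + t *\<^sub>R v))"
    have \<gamma>: "cmod ?\<gamma> = 1" by (simp only: norm_exp_i_times)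
    have b0: "b 0 = F (h y)" by (simp add: b_def fun_eq_iff)
    have bt: "b t = (\<lambda>p. ?\<gamma> * ?z p)" by (simp add: b_def fun_eq_iff)
    \<comment> \<open>Choosing this phase in \<open>cutoff_lipschitz\<close> compares
      \<open>b 0\<close> with \<open>b t\<close> instead of the unrotated values.\<close>
    have "\<bar>u t - u 0\<bar> \<le> cnorm n (\<lambda>p. cunit n (b 0) p - ?\<gamma> * cunit n ?z p) / \<epsilon>"
      using cutoff_lipschitz[OF \<epsilon> \<gamma> x t, of S] by (simp add: u_def b0 abs_minus_commute)
    also have "\<dots> = cnorm n (\<lambda>p. cunit n (b 0) p - cunit n (b t) p) / \<epsilon>"
      by (simp only: bt cunit_mult[OF \<gamma>])
    also have "\<dots> \<le> 2 * cnorm n (\<lambda>p. b 0 p - b t p) / ?N / \<epsilon>"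
      using cnorm_cunit_diff_le[of n "b 0" "b t"] N t \<gamma> \<epsilon>
      by (intro divide_right_mono) (auto simp: b0 bt cnorm_mult nonvanishing_set_iff)
    also have "\<dots> = ?C * cnorm n (\<lambda>p. b t p - b 0 p)"
      by (subst cnorm_minus_commute) simp
    finally have "\<bar>u t - u 0\<bar> \<le> ?C * cnorm n (\<lambda>p. b t p - b 0 p)" .
    then have "inverse \<bar>t\<bar> * \<bar>u t - u 0\<bar> \<le> inverse \<bar>t\<bar> * (?C * cnorm n (\<lambda>p. b t p - b 0 p))"
      by (intro mult_left_mono) auto
    moreover have "cnorm n (\<lambda>p. (b t p - b 0 p) /\<^sub>R t) = inverse \<bar>t\<bar> * cnorm n (\<lambda>p. b t p - b 0 p)"
      using cnorm_mult[of n "of_real (inverse t)" "\<lambda>p. b t p - b 0 p"]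
      by (simp add: scaleR_conv_of_real norm_inverse)
    ultimately show "\<bar>(u t - u 0) /\<^sub>R t\<bar> \<le> ?C * cnorm n (\<lambda>p. (b t p - b 0 p) /\<^sub>R t)"
      by (simp add: abs_mult mult.left_commute)
  qed
  moreover have "((\<lambda>t. \<bar>(u t - u 0) /\<^sub>R t\<bar>) \<longlongrightarrow> \<bar>e' v\<bar>) (at 0)"
    by (intro tendsto_rabs lim_u)
  moreover have "((\<lambda>t. ?C * cnorm n (\<lambda>p. (b t p - b 0 p) /\<^sub>R t)) \<longlongrightarrow> ?C * cnorm n ?d) (at 0)"
    unfolding cnorm_def L2_set_def by (intro tendsto_intros lim_b) auto
  ultimately have "\<bar>e' v\<bar> \<le> ?C * cnorm n ?d"
    by (intro tendsto_le[of "at (0::real)"]) auto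
  \<comment> \<open>Multiplying by \<open>?N\<close> cancels the norm in \<open>?C\<close>; squaring
    \<open>2 / \<epsilon>\<close> then gives the constant of the claim.\<close>
  then have "\<bar>e' v\<bar> * ?N \<le> ?C * cnorm n ?d * ?N"
    using N by (intro mult_right_mono) auto
  also have "\<dots> = (2 / \<epsilon>) * cnorm n ?d"
    using N by simp
  finally have "\<bar>e' v\<bar> * ?N \<le> (2 / \<epsilon>) * cnorm n ?d" .
  then have "(\<bar>e' v\<bar> * ?N)\<^sup>2 \<le> ((2 / \<epsilon>) * cnorm n ?d)\<^sup>2"
    using N by (intro power_mono) auto
  then show ?thesis
    by (simp add: power_mult_distrib power_divide cnorm_power2)
qed

text \<open>Collects what is needed at the chart chosen by \<open>chart_at\<close>. The square root
  in \<open>covector_norm\<close> disappears because the quadratic form is nonnegative.\<close>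

lemma magnetic_energy_eq:
  assumes A: "smooth_atlas A" and g: "riemannian_metric A g"
  shows "magnetic_energy A g \<alpha> n H x = (\<Sum>p=1..n. covector_square (matrix_inv (g (chart_at A x) x))
    (magnetic_differential \<alpha> (\<lambda>y. H y p) (chart_at A x) x))"
    and "chart_at A x \<in> A" "x \<in> chart_dom (chart_at A x)"
    and "transpose (g (chart_at A x) x) = g (chart_at A x) x"
    and "v \<noteq> 0 \<Longrightarrow> v \<bullet> (g (chart_at A x) x *v v) > 0"
proof -
  have "\<exists>c. c \<in> A \<and> x \<in> chart_dom c"
    using A UNIV_I[of x] unfolding smooth_atlas_def by blast
  then have c: "chart_at A x \<in> A \<and> x \<in> chart_dom (chart_at A x)"
    unfolding chart_at_def by (rule someI_ex)
  then show "chart_at A x \<in> A" "x \<in> chart_dom (chart_at A x)" by auto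
  have G: "transpose (g (chart_at A x) x) = g (chart_at A x) x"
    "\<And>v. v \<noteq> 0 \<Longrightarrow> v \<bullet> (g (chart_at A x) x *v v) > 0"
    using g c unfolding riemannian_metric_def by blast+
  then show "transpose (g (chart_at A x) x) = g (chart_at A x) x"
    "v \<noteq> 0 \<Longrightarrow> v \<bullet> (g (chart_at A x) x *v v) > 0" by auto
  show "magnetic_energy A g \<alpha> n H x = (\<Sum>p=1..n. covector_square (matrix_inv (g (chart_at A x) x))
      (magnetic_differential \<alpha> (\<lambda>y. H y p) (chart_at A x) x))"
    using covector_square_nonneg[OF G]
    unfolding magnetic_energy_def covector_norm_def covector_inner_def Let_def covector_square_def[symmetric]
    by simp
qed

text \<open>The pointwise form of the theorem. Differentiability is carried along with the
  inequality because \<open>frechet_derivative\<close>, and with it the energy of the truncated map,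
  is meaningful only at points of differentiability.\<close>

lemma magnetic_energy_cutoff_le:
  fixes A :: "('m::topological_space, 'd::finite) chart set"
  assumes A: "smooth_atlas A" and g: "riemannian_metric A g" and \<epsilon>: "\<epsilon> > 0"
    and F: "\<And>p. p \<in> {1..n} \<Longrightarrow> smooth_fun A (\<lambda>x. F x p)"
    and regular: "differentiable_at_point A
      (if x \<in> nonvanishing_set n F then cutoff n F S \<epsilon> else (\<lambda>y. cnorm n (F y))) x"
  shows "(\<forall>p\<in>{1..n}. differentiable_at_point A (\<lambda>y. of_real (cutoff n F S \<epsilon> y) * F y p) x) \<and>
    magnetic_energy A g \<alpha> n (\<lambda>y p. of_real (cutoff n F S \<epsilon> y) * F y p) x
      \<le> 2 * (1 + 4 / \<epsilon>\<^sup>2) * magnetic_energy A g \<alpha> n F x"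
proof -
  let ?u = "\<lambda>p y. of_real (cutoff n F S \<epsilon> y) * F y p"
  define c where "c = chart_at A x"
  define y where "y = chart_map c x"
  note energy = magnetic_energy_eq[OF A g, where x = x, folded c_def]
  have ch: "is_chart c" using A energy(2) by (auto simp: smooth_atlas_def)
  have xy: "chart_inv c y = x" using energy(3) ch by (simp add: y_def chart_inverse)
  have y: "y \<in> chart_img c" using energy(3) by (simp add: y_def)
  have "\<exists>F'. ((\<lambda>z. F (chart_inv c z) p) has_derivative F') (at y)" if "p \<in> {1..n}" for p
  proof -
    have "smooth_on (chart_img c) ((\<lambda>x. F x p) \<circ> chart_inv c)"
      using F[OF that] energy(2) unfolding smooth_fun_def by blast
    from smooth_on_differentiable[OF this y] show ?thesis
      by (simp add: o_def differentiable_def)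
  qed
  then obtain F' where F': "\<And>p. p \<in> {1..n} \<Longrightarrow> ((\<lambda>z. F (chart_inv c z) p) has_derivative F' p) (at y)"
    by metis
  have frechet: "magnetic_differential \<alpha> v c x = (\<chi> j. v' (axis j 1) + \<i> * of_real (\<alpha> c x $ j) * v x)"
    and diff: "differentiable_at_point A v x"
    if "((\<lambda>z. v (chart_inv c z)) has_derivative v') (at y)" for v v'
  proof -
    have "v' = frechet_derivative (v \<circ> chart_inv c) (at (chart_map c x))"
      using frechet_derivative_at[OF that] by (simp add: y_def o_def)
    then show "magnetic_differential \<alpha> v c x = (\<chi> j. v' (axis j 1) + \<i> * of_real (\<alpha> c x $ j) * v x)"
      by (simp add: magnetic_differential_def differential_def vec_eq_iff)
    show "differentiable_at_point A v x"
      using that by (intro differentiable_at_pointI[OF A energy(2,3)])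
        (auto simp: differentiable_def o_def y_def)
  qed
  show ?thesis
  proof (cases "x \<in> nonvanishing_set n F")
    case True
    have "(cutoff n F S \<epsilon> \<circ> chart_inv c) differentiable (at y)"
      using regular True energy(2,3) by (simp add: differentiable_at_point_def y_def)
    then obtain e' where e': "((\<lambda>z. cutoff n F S \<epsilon> (chart_inv c z)) has_derivative e') (at y)"
      by (auto simp: differentiable_def o_def)
    define D where "D p = magnetic_differential \<alpha> (\<lambda>y. F y p) c x" for p
    define k where "k = (\<chi> j. e' (axis j 1))"
    have u': "((\<lambda>z. ?u p (chart_inv c z)) has_derivative
        (\<lambda>h. of_real (cutoff n F S \<epsilon> x) * F' p h + of_real (e' h) * F x p)) (at y)" if "p \<in> {1..n}" for p
      using has_derivative_mult[OF has_derivative_of_real[OF e'] F'[OF that]] by (simp add: xy)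
    \<comment> \<open>The Leibniz rule: the potential term stays with \<open>F\<close>, and the real
      function in front contributes its plain differential.\<close>
    have Du: "magnetic_differential \<alpha> (?u p) c x
        = (\<chi> j. of_real (k $ j) * F x p) + cutoff n F S \<epsilon> x *\<^sub>R D p" if "p \<in> {1..n}" for p
      unfolding frechet[OF u'[OF that]] D_def frechet[OF F'[OF that]] k_def vec_eq_iff vector_add_component
        vector_scaleR_component vec_lambda_beta
      by (simp add: scaleR_conv_of_real algebra_simps)
    have k: "e' v = k \<bullet> v" for v
      using linear_axis_expansion[OF has_derivative_linear[OF e'], of v]
      by (simp add: k_def inner_vec_def mult.commute)
    have D: "(\<Sum>j\<in>UNIV. v $ j *\<^sub>R D p $ j) = F' p v + \<i> * of_real (\<alpha> c x \<bullet> v) * F x p"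
      if "p \<in> {1..n}" for p v
      using linear_axis_expansion[OF has_derivative_linear[OF F'[OF that]], of v] frechet[OF F'[OF that]]
      by (simp add: D_def inner_vec_def scaleR_conv_of_real sum.distrib sum_distrib_left
          sum_distrib_right algebra_simps)
    have "(k \<bullet> v)\<^sup>2 * (cnorm n (F x))\<^sup>2
        \<le> 4 / \<epsilon>\<^sup>2 * (\<Sum>p=1..n. (cmod (\<Sum>j\<in>UNIV. v $ j *\<^sub>R D p $ j))\<^sup>2)" for v
      \<comment> \<open>The free number \<open>a\<close> is set to the value of the potential on
        \<open>v\<close>, which makes \<open>D\<close> applicable.\<close>
      using cutoff_directional_derivative_le[OF \<epsilon> _ e' F', of v "\<alpha> c x \<bullet> v"] True
      by (simp add: xy k D)
    from leibniz_energy_bound[OF energy(4,5) cutoff_bounds[OF \<epsilon>] _ this]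
    have "(\<Sum>p=1..n. covector_square (matrix_inv (g c x)) (magnetic_differential \<alpha> (?u p) c x))
        \<le> 2 * (1 + 4 / \<epsilon>\<^sup>2) * (\<Sum>p=1..n. covector_square (matrix_inv (g c x)) (D p))"
      by (simp add: Du)
    then show ?thesis
      using diff[OF u'] by (simp add: energy(1) D_def)
  next
    case False
    then have zero: "cnorm n (F x) = 0"
      using nonvanishing_set_iff[of x n F] by (simp add: less_le)
    then have Fx: "F x p = 0" if "p \<in> {1..n}" for p
      using that cnorm_eq_0_iff by blast
    have "((\<lambda>y. cnorm n (F y)) \<circ> chart_inv c) differentiable (at y)"
      using regular False energy(2,3) by (simp add: differentiable_at_point_def y_def)
    then obtain s' where s': "((\<lambda>z. cnorm n (F (chart_inv c z))) has_derivative s') (at y)"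
      by (auto simp: differentiable_def o_def)
    \<comment> \<open>The norm is nonnegative and vanishes at \<open>y\<close>, so it has a minimum
      there.\<close>
    have "s' = (\<lambda>h. 0)"
      using zero by (intro differential_zero_maxmin[OF UNIV_I open_UNIV s']) (simp add: xy)
    with s' have s'0: "((\<lambda>z. cnorm n (F (chart_inv c z))) has_derivative (\<lambda>h. 0)) (at y)" by simp
    \<comment> \<open>No regularity of the cut-off is needed at a zero of \<open>F\<close>: it lies
      between 0 and 1, so the product is dominated by the norm of \<open>F\<close>, which is of
      smaller order than \<open>norm (z - y)\<close>.\<close>
    have u': "((\<lambda>z. ?u p (chart_inv c z)) has_derivative (\<lambda>h. 0)) (at y)" if p: "p \<in> {1..n}" for p
      unfolding has_derivative_at_alt
    proof (intro conjI allI impI)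
      show "bounded_linear (\<lambda>h::real^'d. 0::complex)" by (rule bounded_linear_zero)
      fix e :: real assume "e > 0"
      then obtain d where d: "d > 0" "\<And>z. norm (z - y) < d \<Longrightarrow> cnorm n (F (chart_inv c z)) \<le> e * norm (z - y)"
        using s'0 zero unfolding has_derivative_at_alt by (auto simp: xy)
      have "cmod (?u p z) \<le> cnorm n (F z)" for z
      proof -
        have "cmod (?u p z) = cutoff n F S \<epsilon> z * cmod (F z p)"
          using cutoff_bounds[OF \<epsilon>, of n F S z] by (simp add: norm_mult)
        also have "\<dots> \<le> 1 * cnorm n (F z)"
          using cutoff_bounds[OF \<epsilon>, of n F S z] cmod_le_cnorm[OF p] by (intro mult_mono) auto
        finally show ?thesis by simp
      qed
      then have "cmod (?u p (chart_inv c z)) \<le> e * norm (z - y)" if "norm (z - y) < d" for z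
        using d(2)[OF that] order_trans by blast
      then show "\<exists>d>0. \<forall>z. norm (z - y) < d \<longrightarrow>
          norm (?u p (chart_inv c z) - ?u p (chart_inv c y) - 0) \<le> e * norm (z - y)"
        using d(1) by (intro exI[of _ d]) (simp add: xy Fx[OF p])
    qed
    have "covector_square (matrix_inv (g c x)) (magnetic_differential \<alpha> (?u p) c x) = 0" if "p \<in> {1..n}" for p
      unfolding frechet[OF u'[OF that]] by (simp add: Fx[OF that] covector_square_def)
    then have "magnetic_energy A g \<alpha> n (\<lambda>y p. ?u p y) x = 0"
      by (simp add: energy(1))
    moreover have "0 \<le> magnetic_energy A g \<alpha> n F x"
      by (simp add: magnetic_energy_def sum_nonneg)
    ultimately show ?thesis using diff[OF u'] by simp
  qed
qed

theorem lemma7p8: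
  fixes A :: "('m::{t2_space, second_countable_topology}, 'd::finite) chart set"
    and g :: "('m, 'd) metric"
    and \<alpha> :: "('m, 'd, real) form1"
    and n :: nat
    and F :: "'m \<Rightarrow> nat \<Rightarrow> complex"
    and S :: "'m set"
    and \<epsilon> :: real
  assumes "compact (UNIV :: 'm set)" and "connected (UNIV :: 'm set)"
    and "smooth_atlas A" and "riemannian_metric A g" and "smooth_form1 A \<alpha>"
    and "n \<ge> 1"
    and "\<And>p. p \<in> {1..n} \<Longrightarrow>
           magnetic_eigenfunction A g \<alpha> (magnetic_eigenvalue A g \<alpha> p) (\<lambda>x. F x p)"
    and "\<And>p q. p \<in> {1..n} \<Longrightarrow> q \<in> {1..n} \<Longrightarrow>
           L2_inner A g (\<lambda>x. F x p) (\<lambda>x. F x q) = (if p = q then 1 else 0)"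
    and "\<epsilon> > 0"
  shows "AE x in riemannian_volume A g.
           (\<forall>p\<in>{1..n}. differentiable_at_point A (\<lambda>y. of_real (cutoff n F S \<epsilon> y) * F y p) x) \<and>
           magnetic_energy A g \<alpha> n (\<lambda>y p. of_real (cutoff n F S \<epsilon> y) * F y p) x
             \<le> 2 * (1 + 4 / \<epsilon>\<^sup>2) * magnetic_energy A g \<alpha> n F x"
proof -
  \<comment> \<open>Smoothness is part of the definition of the eigenspace.\<close>
  have F: "smooth_fun A (\<lambda>x. F x p)" if "p \<in> {1..n}" for p
    using assms(7)[OF that] by (simp add: magnetic_eigenfunction_def magnetic_eigenspace_def)
  have "AE x in riemannian_volume A g. differentiable_at_point A
      (if x \<in> nonvanishing_set n F then cutoff n F S \<epsilon> else (\<lambda>y. cnorm n (F y))) x"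
    using F by (rule AE_cutoff_regular[OF assms(3,4,9)])
  then show ?thesis
    by (rule AE_mp) (intro AE_I2 impI magnetic_energy_cutoff_le assms(3,4,9) F)
qed

end
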